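(* Let $f:\mathbb{R}^d\to\mathbb{R}^d$ be globally Lipschitz continuous, let $g\in C^3_b(\mathbb{R}^d,\mathcal{L}(\mathbb{R}^m,\mathbb{R}^d))$, and let $\mathbf{x}=(x,\mathbb{X})$ be a $\nu$-Hölder rough path on $[a,b]$ over $\mathbb{R}^m$. Then for every $y_a\in\mathbb{R}^d$ there exists a solution on the interval $[a,b]$, with initial value $y_a$, of the rough differential equation $$dy_t=f(y_t)\,dt+g(y_t)\,dx_t,\qquad t\in[a,b].$$
   Context: Parameters: $\frac13<\alpha<\nu<\frac12$. Write $y_{s,t}=y_t-y_s$. $C^3_b$ means three times continuously differentiable with $g$ and its derivatives up to order 3 bounded. $C^\alpha(I,W)$ is the space of $\alpha$-Hölder paths on the compact interval $I$, and $C^{2\alpha}(I^2,W)$ the continuous two-parameter functions with $\sup_{s<t}\|R_{s,t}\|/|t-s|^{2\alpha}<\infty$. Rough path: a $\nu$-Hölder rough path on $I$ over $\mathbb{R}^m$ is $\mathbf{x}=(x,\mathbb{X})$ with $x\in C^\nu(I,\mathbb{R}^m)$, $\mathbb{X}\in C^{2\nu}(I^2,\mathbb{R}^m\otimes\mathbb{R}^m)$ and $\mathbb{X}_{s,t}-\mathbb{X}_{s,u}-\mathbb{X}_{u,t}=x_{s,u}\otimes x_{u,t}$ for $s\le u\le t$. Controlled paths: $(y,y')\in\mathcal{D}^{2\alpha}_x(I)$ with values in $W$ means $y\in C^\alpha(I,W)$, $y'\in C^\alpha(I,\mathcal{L}(\mathbb{R}^m,W))$ and $y_{s,t}=y'_sx_{s,t}+R^y_{s,t}$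 for $s\le t$ with $R^y\in C^{2\alpha}(I^2,W)$. For a controlled path $(Y,Y')$ with values in $\mathcal{L}(\mathbb{R}^m,\mathbb{R}^d)$ the Gubinelli rough integral is $\int_s^tY_u\,dx_u=\lim_{|\Pi|\to0}\sum_{[u,v]\in\Pi}\big(Y_ux_{u,v}+Y'_u\mathbb{X}_{u,v}\big)$ over finite partitions $\Pi$ of $[s,t]$, where $A\in\mathcal{L}(\mathbb{R}^m,\mathcal{L}(\mathbb{R}^m,\mathbb{R}^d))$ acts on $\mathbb{R}^m\otimes\mathbb{R}^m$ by $A(u\otimes v)=(Au)v$. Solution: a path $y$ with $(y,y')\in\mathcal{D}^{2\alpha}_x([a,b])$, $y'_t=g(y_t)$, initial value $y_a$, and $y_t=y_a+\int_a^tf(y_u)\,du+\int_a^tg(y_u)\,dx_u$ for all $t\in[a,b]$, where the integrand $g(y)$ has Gubinelli derivative $[g(y)]'_s=Dg(y_s)g(y_s)$, i.e. $u\otimes v\mapsto(Dg(y_s)[g(y_s)u])v$. *)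

theory Defs
  imports "HOL-Analysis.Analysis"
begin

definition holder_path :: "real \<Rightarrow> real set \<Rightarrow> (real \<Rightarrow> 'w::real_normed_vector) \<Rightarrow> bool" where
  "holder_path \<alpha> I y \<longleftrightarrow>
     (\<exists>C. \<forall>s\<in>I. \<forall>t\<in>I. norm (y t - y s) \<le> C * \<bar>t - s\<bar> powr \<alpha>)"

text \<open>The exponent \<open>\<beta>\<close> below is the one of the bound itself; it is used with \<open>2 * \<alpha>\<close> and \<open>2 * \<nu>\<close>.\<close>

definition holder_two_param :: "real \<Rightarrow> real set \<Rightarrow> (real \<Rightarrow> real \<Rightarrow> 'w::real_normed_vector) \<Rightarrow> bool" where
  "holder_two_param \<beta> I R \<longleftrightarrow>
     continuous_on (I \<times> I) (\<lambda>(s, t). R s t) \<and>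
     (\<exists>C. \<forall>s\<in>I. \<forall>t\<in>I. s < t \<longrightarrow> norm (R s t) \<le> C * \<bar>t - s\<bar> powr \<beta>)"

text \<open>The tensor product of \<open>real ^ 'm\<close> with itself is represented by \<open>real ^ 'm ^ 'm\<close>; the entry
  \<open>(i, j)\<close> is the coefficient of the tensor of the basis vectors \<open>i\<close> and \<open>j\<close>, in this order.\<close>

definition tensor :: "real ^ 'm \<Rightarrow> real ^ 'm \<Rightarrow> real ^ 'm ^ 'm" where
  "tensor u v = (\<chi> i j. u $ i * v $ j)"

definition tensor_apply ::
  "((real ^ 'm) \<Rightarrow>\<^sub>L (real ^ 'm) \<Rightarrow>\<^sub>L 'w::real_normed_vector) \<Rightarrow> real ^ 'm ^ 'm \<Rightarrow> 'w" where
  "tensor_apply A M =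
     (\<Sum>i\<in>UNIV. \<Sum>j\<in>UNIV. (M $ i $ j) *\<^sub>R blinfun_apply (blinfun_apply A (axis i 1)) (axis j 1))"

lemma linear_tensor_apply: "linear (tensor_apply A)"
  by (rule linearI)
     (simp_all add: tensor_apply_def scaleR_add_left sum.distrib scaleR_sum_right)

lemma tensor_apply_tensor:
  "tensor_apply A (tensor u v) = blinfun_apply (blinfun_apply A u) v"
proof -
  have u: "u = (\<Sum>i\<in>UNIV. u $ i *\<^sub>R axis i 1)" for u :: "real ^ 'm"
    by (simp add: basis_expansion flip: scalar_mult_eq_scaleR)
  have "blinfun_apply (blinfun_apply A u) v =
      blinfun_apply (blinfun_apply A (\<Sum>i\<in>UNIV. u $ i *\<^sub>R axis i 1)) (\<Sum>j\<in>UNIV. v $ j *\<^sub>R axis j 1)"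
    by (simp flip: u)
  also have "\<dots> = tensor_apply A (tensor u v)"
    by (simp add: tensor_apply_def tensor_def blinfun.sum_left blinfun.sum_right
        blinfun.scaleR_left blinfun.scaleR_right scaleR_sum_right mult.commute)
      (subst sum.swap, simp)
  finally show ?thesis ..
qed

definition rough_path ::
  "real \<Rightarrow> real set \<Rightarrow> (real \<Rightarrow> real ^ 'm) \<Rightarrow> (real \<Rightarrow> real \<Rightarrow> real ^ 'm ^ 'm) \<Rightarrow> bool" where
  "rough_path \<nu> I x X \<longleftrightarrow>
     holder_path \<nu> I x \<and> holder_two_param (2 * \<nu>) I X \<and>
     (\<forall>s\<in>I. \<forall>u\<in>I. \<forall>t\<in>I. s \<le> u \<and> u \<le> t \<longrightarrow>
        X s t - X s u - X u t = tensor (x u - x s) (x t - x u))"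

definition controlled_path ::
  "real \<Rightarrow> real set \<Rightarrow> (real \<Rightarrow> real ^ 'm) \<Rightarrow>
   (real \<Rightarrow> 'w::real_normed_vector) \<Rightarrow> (real \<Rightarrow> (real ^ 'm) \<Rightarrow>\<^sub>L 'w) \<Rightarrow> bool" where
  "controlled_path \<alpha> I x y y' \<longleftrightarrow>
     holder_path \<alpha> I y \<and> holder_path \<alpha> I y' \<and>
     (\<exists>R. holder_two_param (2 * \<alpha>) I R \<and>
        (\<forall>s\<in>I. \<forall>t\<in>I. s \<le> t \<longrightarrow> y t - y s = blinfun_apply (y' s) (x t - x s) + R s t))"

text \<open>The limit of the compensated Riemann sums as the mesh of the partition tends to 0. A
  \<open>division_of\<close> may contain one-point intervals; for a rough path these contribute 0 to the sum,
  since \<open>X u u = 0\<close> by Chen's relation.\<close>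

definition has_rough_integral ::
  "(real \<Rightarrow> real ^ 'm) \<Rightarrow> (real \<Rightarrow> real \<Rightarrow> real ^ 'm ^ 'm) \<Rightarrow>
   (real \<Rightarrow> (real ^ 'm) \<Rightarrow>\<^sub>L 'w::real_normed_vector) \<Rightarrow> (real \<Rightarrow> (real ^ 'm) \<Rightarrow>\<^sub>L (real ^ 'm) \<Rightarrow>\<^sub>L 'w) \<Rightarrow>
   'w \<Rightarrow> real \<Rightarrow> real \<Rightarrow> bool" where
  "has_rough_integral x X Y Y' J s t \<longleftrightarrow>
     (\<forall>\<epsilon>>0. \<exists>\<delta>>0. \<forall>D. D division_of {s..t} \<and> (\<forall>k\<in>D. Sup k - Inf k < \<delta>) \<longrightarrow>
        norm ((\<Sum>k\<in>D. blinfun_apply (Y (Inf k)) (x (Sup k) - x (Inf k)) +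
                        tensor_apply (Y' (Inf k)) (X (Inf k) (Sup k))) - J) < \<epsilon>)"

text \<open>The Frechet derivative as a bounded linear map, so that it can be differentiated again.\<close>

definition fderiv ::
  "('a::real_normed_vector \<Rightarrow> 'b::real_normed_vector) \<Rightarrow> 'a \<Rightarrow> 'a \<Rightarrow>\<^sub>L 'b" where
  "fderiv g z = Blinfun (frechet_derivative g (at z))"

lemma has_derivative_fderiv:
  assumes "g differentiable (at z)"
  shows "(g has_derivative blinfun_apply (fderiv g z)) (at z)"
  using assms unfolding fderiv_def
  by (metis bounded_linear_Blinfun_apply frechet_derivative_works has_derivative_bounded_linear)

definition C3b :: "('a::real_normed_vector \<Rightarrow> 'b::real_normed_vector) \<Rightarrow> bool" where
  "C3b g \<longleftrightarrow>
     (\<forall>z. g differentiable (at z)) \<and>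
     (\<forall>z. fderiv g differentiable (at z)) \<and>
     (\<forall>z. fderiv (fderiv g) differentiable (at z)) \<and>
     continuous_on UNIV (fderiv (fderiv (fderiv g))) \<and>
     bounded (range g) \<and>
     bounded (range (fderiv g)) \<and>
     bounded (range (fderiv (fderiv g))) \<and>
     bounded (range (fderiv (fderiv (fderiv g))))"

text \<open>The Gubinelli derivative of \<open>\<lambda>t. g (y t)\<close> at \<open>s\<close> is the composition
  \<open>fderiv g (y s) o\<^sub>L g (y s)\<close>, which maps \<open>u\<close> to \<open>fderiv g (y s) (g (y s) u)\<close>.\<close>

definition rde_solution ::
  "real \<Rightarrow> real \<Rightarrow> real \<Rightarrow> (real \<Rightarrow> real ^ 'm) \<Rightarrow> (real \<Rightarrow> real \<Rightarrow> real ^ 'm ^ 'm) \<Rightarrow>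
   (real ^ 'd \<Rightarrow> real ^ 'd) \<Rightarrow> (real ^ 'd \<Rightarrow> (real ^ 'm) \<Rightarrow>\<^sub>L (real ^ 'd)) \<Rightarrow>
   real ^ 'd \<Rightarrow> (real \<Rightarrow> real ^ 'd) \<Rightarrow> bool" where
  "rde_solution \<alpha> a b x X f g y0 y \<longleftrightarrow>
     controlled_path \<alpha> {a..b} x y (\<lambda>t. g (y t)) \<and>
     controlled_path \<alpha> {a..b} x (\<lambda>t. g (y t)) (\<lambda>t. fderiv g (y t) o\<^sub>L g (y t)) \<and>
     y a = y0 \<and>
     (\<forall>t\<in>{a..b}. \<exists>F J.
        ((\<lambda>u. f (y u)) has_integral F) {a..t} \<and>
        has_rough_integral x X (\<lambda>u. g (y u)) (\<lambda>u. fderiv g (y u) o\<^sub>L g (y u)) J a t \<and>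
        y t = y a + F + J)"

end

theory Submission
  imports Defs
begin

text \<open>The proof follows Davie's approach: a solution is a path \<open>y\<close> whose increments agree with those of the second
  order Euler step
  \<open>\<phi> s t z = (t - s) *\<^sub>R f z + g z (x t - x s) + tensor_apply (fderiv g z o\<^sub>L g z) (X s t)\<close>
  at \<open>z = y s\<close> up to an error of order \<open>3 * \<nu> > 1\<close>.

  Such a path is constructed as a limit of Euler schemes. What makes this work are two properties of \<open>\<phi>\<close>: the maps
  \<open>z \<mapsto> z + \<phi> s t z\<close> compose up to a defect of order \<open>3 * \<nu>\<close> that grows linearly in \<open>z\<close> (Chen's relation cancels all
  terms of lower order, lemma \<open>rde_step_almost_flow\<close>), and \<open>\<phi> s t\<close> is Lipschitz with a constant that tends to \<open>0\<close>
  with \<open>t - s\<close>. In this abstract setting, the locale \<open>almost_flow\<close>, repeated bisection shows that the Euler scheme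
  stays close to the approximate flow on intervals of a fixed length \<open>\<tau>\<close>, with constants that depend neither on the mesh
  nor on the initial value (lemma \<open>euler_local_error\<close>). The length \<open>\<tau>\<close> is independent of the size of the solution
  because the unbounded drift \<open>f\<close> enters all estimates linearly only; hence finitely many intervals of length \<open>\<tau>\<close>
  cover \<open>{a..b}\<close>, no explosion takes place, and the schemes are bounded uniformly in the mesh. A pointwise cluster
  point exists by compactness of products of balls, and it inherits the estimate (theorem \<open>davie_path_exists\<close>).

  Conversely, a path with this expansion is a solution (lemma \<open>rde_solution_if_davie_expansion\<close>). The controlled path
  properties are read off from the expansion. For the rough integral, \<open>Z = y - \<integral> f(y)\<close> has the compensated
  increments of \<open>g(y)\<close> as its local expansion up to the order \<open>3 * \<nu>\<close>, and summing over a partition shows that the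
  compensated Riemann sums converge to the increment of \<open>Z\<close>.\<close>

section \<open>The Euler scheme of an almost flow\<close>

text \<open>This is where exponents above \<open>1\<close> matter: when an interval of \<open>n \<ge> 2\<close> mesh cells is cut in the
  middle, both parts have at most \<open>2 n / 3\<close> cells (the extreme case is \<open>n = 3\<close>), so the sum of the
  \<open>\<theta>\<close>-th powers of the lengths drops by a factor strictly below \<open>1\<close>.\<close>

lemma powr_midpoint_contraction:
  fixes n k :: nat and h \<theta> :: real
  assumes "k = n div 2" and "2 \<le> n" and "0 \<le> h" and "1 < \<theta>"
  shows "(real k * h) powr \<theta> + (real (n - k) * h) powr \<theta>
           \<le> (2/3) powr (\<theta> - 1) * (real n * h) powr \<theta>"
proof -
  have part: "(real j * h) powr \<theta> \<le> (2/3) powr (\<theta> - 1) * (real n * h) powr (\<theta> - 1) * (real j * h)"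
    if "3 * j \<le> 2 * n" for j
  proof -
    have "(real j * h) powr \<theta> = (real j * h) powr (\<theta> - 1) * (real j * h)"
      using powr_add[of "real j * h" "\<theta> - 1" 1] \<open>0 \<le> h\<close> by simp
    also have "(real j * h) powr (\<theta> - 1) \<le> (2/3 * (real n * h)) powr (\<theta> - 1)"
    proof (rule powr_mono2)
      have "real j \<le> 2/3 * real n"
        using that by linarith
      then show "real j * h \<le> 2/3 * (real n * h)"
        using mult_right_mono[OF _ \<open>0 \<le> h\<close>] by fastforce
    qed (use assms in auto)
    also have "\<dots> = (2/3) powr (\<theta> - 1) * (real n * h) powr (\<theta> - 1)"
      using assms by (intro powr_mult)
    finally show ?thesis
      using \<open>0 \<le> h\<close> by (simp add: mult_right_mono)
  qed
  have "(real k * h) powr \<theta> + (real (n - k) * h) powr \<theta>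
      \<le> (2/3) powr (\<theta> - 1) * (real n * h) powr (\<theta> - 1) * (real k * h)
        + (2/3) powr (\<theta> - 1) * (real n * h) powr (\<theta> - 1) * (real (n - k) * h)"
    using assms by (intro add_mono part) auto
  also have "\<dots> = (2/3) powr (\<theta> - 1) * ((real n * h) powr (\<theta> - 1) * (real n * h))"
    using assms by (simp add: of_nat_diff algebra_simps)
  also have "(real n * h) powr (\<theta> - 1) * (real n * h) = (real n * h) powr \<theta>"
    using powr_add[of "real n * h" "\<theta> - 1" 1] \<open>0 \<le> h\<close> by simp
  finally show ?thesis .
qed

lemma norm_triangle_4:
  fixes p q r s :: "'a::real_normed_vector"
  shows "norm (p + q + r - s) \<le> norm p + norm q + norm r + norm s"
  using norm_triangle_ineq4[of "p + q + r" s] norm_triangle_ineq[of "p + q" r] norm_triangle_ineq[of p q]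
  by linarith

text \<open>The map \<open>z \<mapsto> z + \<phi> s t z\<close> approximates the flow of an equation from time \<open>s\<close> to time \<open>t\<close>. It fails
  to be a flow only by the defect, which is of order \<open>\<theta> > 1\<close> and therefore summable over fine
  partitions. The weight \<open>1 + norm z\<close> admits vector fields of linear growth. The Lipschitz bound is
  for the increment \<open>\<phi>\<close> rather than for the approximate flow itself, so that its constant tends to \<open>0\<close>
  on short intervals.\<close>

locale almost_flow =
  fixes \<phi> :: "real \<Rightarrow> real \<Rightarrow> 'e::euclidean_space \<Rightarrow> 'e" and a b C \<nu> \<theta> :: real
  assumes C_nonneg: "0 \<le> C" and \<nu>_pos: "0 < \<nu>" and \<theta>_gt_1: "1 < \<theta>"
    and growth: "\<And>s t z. a \<le> s \<Longrightarrow> s \<le> t \<Longrightarrow> t \<le> b \<Longrightarrow>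
      norm (\<phi> s t z) \<le> C * (t - s) powr \<nu> * (1 + norm z)"
    and lipschitz: "\<And>s t z w. a \<le> s \<Longrightarrow> s \<le> t \<Longrightarrow> t \<le> b \<Longrightarrow>
      norm (\<phi> s t z - \<phi> s t w) \<le> C * (t - s) powr \<nu> * norm (z - w)"
    and defect: "\<And>s u t z. a \<le> s \<Longrightarrow> s \<le> u \<Longrightarrow> u \<le> t \<Longrightarrow> t \<le> b \<Longrightarrow>
      norm (\<phi> s t z - \<phi> s u z - \<phi> u t (z + \<phi> s u z)) \<le> C * (t - s) powr \<theta> * (1 + norm z)"
    and continuous: "\<And>z. continuous_on ({a..b} \<times> {a..b}) (\<lambda>(s, t). \<phi> s t z)"
begin

primrec euler :: "real \<Rightarrow> 'e \<Rightarrow> nat \<Rightarrow> 'e" where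
  "euler h z 0 = z"
| "euler h z (Suc i) = euler h z i + \<phi> (a + real i * h) (a + real (Suc i) * h) (euler h z i)"

lemma \<phi>_refl: "a \<le> s \<Longrightarrow> s \<le> b \<Longrightarrow> \<phi> s s z = 0"
  using growth[of s s z] by simp

text \<open>The discrete counterpart of the sewing lemma. Over at most one mesh cell the Euler scheme agrees
  with the approximate flow. A longer interval is cut in the middle: its error is the sum of the
  errors of the two halves, the propagation of the first error through \<open>\<phi>\<close>, and the defect. By
  \<open>powr_midpoint_contraction\<close> the halves contribute a fraction \<open>\<kappa> < 1\<close> of the claimed bound, up to
  perturbations that vanish with \<open>\<tau>\<close>, which leaves room for the other
  two terms when \<open>M\<close> is large and \<open>\<tau>\<close> is small. The error is weighted with the size of the scheme at
  the left end point. Over a time \<open>\<tau>\<close> this weight grows at most by a factor below \<open>1 / \<kappa>\<close>, which the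
  induction absorbs as well, so that \<open>M\<close> and \<open>\<tau>\<close> depend neither on the mesh nor on the initial value.\<close>

lemma euler_local_error:
  obtains M \<tau> where "0 \<le> M" and "0 < \<tau>" and "\<tau> \<le> 1"
    and "\<And>h z i j. 0 < h \<Longrightarrow> i \<le> j \<Longrightarrow> a + real j * h \<le> b \<Longrightarrow> real (j - i) * h \<le> \<tau> \<Longrightarrow>
      norm (euler h z j - euler h z i - \<phi> (a + real i * h) (a + real j * h) (euler h z i))
        \<le> M * (real (j - i) * h) powr \<theta> * (1 + norm (euler h z i))"
proof -
  define \<kappa> :: real where "\<kappa> = (2/3) powr (\<theta> - 1)"
  have \<kappa>: "0 < \<kappa>" "\<kappa> < 1"
    using \<theta>_gt_1 powr_less_mono2[of "\<theta> - 1" "2/3" 1] by (auto simp: \<kappa>_def)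
  \<comment> \<open>\<open>M\<close> solves \<open>M * (1 + \<kappa>) / 2 + C = M\<close>: the halves, with their perturbation by the choice of \<open>\<tau>\<close>, may
    use up the fraction \<open>(1 + \<kappa>) / 2\<close> of the bound, the defect the rest.\<close>
  define M where "M = 2 * C / (1 - \<kappa>)"
  have M: "0 \<le> M" "\<kappa> * M * ((1 + \<kappa>) / (2 * \<kappa>)) + C = M"
    using \<kappa> C_nonneg by (auto simp: M_def field_simps)
  obtain \<tau> where \<tau>: "0 < \<tau>" "\<tau> \<le> 1" "1 + C * \<tau> powr \<nu> + M * \<tau> powr \<theta> \<le> (1 + \<kappa>) / (2 * \<kappa>)"
  proof -
    have "((\<lambda>\<tau>. 1 + C * \<tau> powr \<nu> + M * \<tau> powr \<theta>) \<longlongrightarrow> 1 + C * 0 powr \<nu> + M * 0 powr \<theta>) (at_right 0)"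
      using \<nu>_pos \<theta>_gt_1 
      by (intro tendsto_intros tendsto_powr2) (auto simp: eventually_at_right_less eventually_at intro!: exI[of _ 1])
    moreover have "1 + C * 0 powr \<nu> + M * 0 powr \<theta> < (1 + \<kappa>) / (2 * \<kappa>)"
      using \<kappa> by (simp add: field_simps)
    ultimately have "\<forall>\<^sub>F \<tau> in at_right 0. 1 + C * \<tau> powr \<nu> + M * \<tau> powr \<theta> < (1 + \<kappa>) / (2 * \<kappa>)"
      by (rule order_tendstoD(2))
    moreover have "\<forall>\<^sub>F \<tau> in at_right 0. \<tau> \<in> {0<..<1::real}"
      by (rule eventually_at_right_real) simp
    ultimately have "\<forall>\<^sub>F \<tau> in at_right 0. \<tau> \<in> {0<..<1} \<and> 1 + C * \<tau> powr \<nu> + M * \<tau> powr \<theta> < (1 + \<kappa>) / (2 * \<kappa>)"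
      by (rule eventually_conj[rotated])
    then have "\<exists>\<tau>. \<tau> \<in> {0<..<1} \<and> 1 + C * \<tau> powr \<nu> + M * \<tau> powr \<theta> < (1 + \<kappa>) / (2 * \<kappa>)"
      by (rule eventually_happens'[rotated]) simp
    then show ?thesis
      using that by fastforce
  qed
  have bound: "norm (euler h z j - euler h z i - \<phi> (a + real i * h) (a + real j * h) (euler h z i))
      \<le> M * (real (j - i) * h) powr \<theta> * (1 + norm (euler h z i))"
    if h: "0 < h" and "i \<le> j" "a + real j * h \<le> b" "real (j - i) * h \<le> \<tau>" for h z i j
    using that(2-)
  proof (induction "j - i" arbitrary: i j rule: less_induct)
    case less
    let ?y = "euler h z"
    let ?t = "\<lambda>i. a + real i * h"
    consider "j = i" | "j = Suc i" | "2 \<le> j - i"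
      using less.prems(1) by linarith
    then show ?case
    proof cases
      case 1
      then show ?thesis
        using less.prems h \<phi>_refl by (simp add: mult_nonneg_nonneg)
    next
      case 2
      then show ?thesis
        using M(1) by (auto intro!: mult_nonneg_nonneg)
    next
      case 3
      define n where "n = j - i"
      define k where "k = n div 2"
      define u where "u = i + k"
      have idx: "i \<le> u" "u \<le> j" "u - i = k" "j - u = n - k" "k < n" "n - k < n" "k \<le> n" "0 < k"
        using 3 by (auto simp: n_def k_def u_def)
      have times: "a \<le> ?t i" "?t i \<le> ?t u" "?t u \<le> ?t j" "?t j \<le> b"
        using h idx less.prems by (auto intro!: mult_right_mono)
      have "real k * h \<le> real n * h" "real (n - k) * h \<le> real n * h"
        using idx h by (auto intro!: mult_right_mono)
      then have small: "real k * h \<le> \<tau>" "real (n - k) * h \<le> \<tau>"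
        using less.prems(3) by (auto simp: n_def)
      define r1 where "r1 = (real k * h) powr \<theta>"
      define r2 where "r2 = (real (n - k) * h) powr \<theta>"
      define r where "r = (real n * h) powr \<theta>"
      have r: "r1 + r2 \<le> \<kappa> * r" "0 \<le> r1" "0 \<le> r2"
        unfolding r1_def r2_def r_def \<kappa>_def
        using powr_midpoint_contraction[OF k_def] 3 h \<theta>_gt_1 by (auto simp: n_def)
      have r1_le: "r1 \<le> \<tau> powr \<theta>"
        unfolding r1_def using small h \<theta>_gt_1 by (intro powr_mono2) auto
      define w where "w = 1 + norm (?y i)"
      have w: "1 \<le> w" by (simp add: w_def)
      define z' where "z' = ?y i + \<phi> (?t i) (?t u) (?y i)"
      have J1: "norm (?y u - z') \<le> M * r1 * w"
        using less.hyps[of u i] idx less.prems small times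
        by (simp add: z'_def r1_def w_def n_def diff_diff_eq)
      have J2: "norm (?y j - ?y u - \<phi> (?t u) (?t j) (?y u)) \<le> M * r2 * (1 + norm (?y u))"
        using less.hyps[of j u] idx less.prems small times by (simp add: r2_def n_def)
      have tk: "?t u - ?t i = real k * h" "?t j - ?t u = real (n - k) * h" "?t j - ?t i = real n * h"
        using idx by (auto simp: n_def of_nat_diff algebra_simps u_def)
      define A where "A = C * \<tau> powr \<nu>"
      have "0 \<le> A"
        using C_nonneg by (simp add: A_def)
      have step: "C * (real k * h) powr \<nu> \<le> A" "C * (real (n - k) * h) powr \<nu> \<le> A"
        unfolding A_def using small h \<nu>_pos C_nonneg by (auto intro!: mult_left_mono powr_mono2)
      have G: "norm (\<phi> (?t i) (?t u) (?y i)) \<le> A * w"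
        using growth[of "?t i" "?t u" "?y i", unfolded tk] times
          mult_right_mono[OF step(1), of w] by (simp add: w_def)
      have L: "norm (\<phi> (?t u) (?t j) (?y u) - \<phi> (?t u) (?t j) z') \<le> A * (M * r1 * w)"
      proof -
        have "norm (\<phi> (?t u) (?t j) (?y u) - \<phi> (?t u) (?t j) z') \<le> C * (real (n - k) * h) powr \<nu> * norm (?y u - z')"
          using lipschitz[of "?t u" "?t j" "?y u" z', unfolded tk] times order_trans[OF times(1,2)] by blast
        also have "\<dots> \<le> A * (M * r1 * w)"
          using J1 step \<open>0 \<le> A\<close> by (intro mult_mono) auto
        finally show ?thesis .
      qed
      have D: "norm (\<phi> (?t i) (?t j) (?y i) - \<phi> (?t i) (?t u) (?y i) - \<phi> (?t u) (?t j) z') \<le> C * r * w"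
        using defect[of "?t i" "?t u" "?t j" "?y i", unfolded tk] times unfolding z'_def r_def w_def by blast
      define q where "q = 1 + A + M * \<tau> powr \<theta>"
      have yu: "1 + norm (?y u) \<le> q * w"
      proof -
        have "norm (?y u) \<le> norm (?y i) + norm (\<phi> (?t i) (?t u) (?y i)) + norm (?y u - z')"
          unfolding z'_def by (smt (verit) norm_triangle_ineq add_diff_cancel_left' diff_add_cancel)
        also have "\<dots> \<le> norm (?y i) + A * w + M * \<tau> powr \<theta> * w"
          using G J1 mult_right_mono[OF mult_left_mono[OF r1_le M(1)], of w] w by simp
        finally show ?thesis
          by (simp add: q_def w_def algebra_simps)
      qed
      have "?y j - ?y i - \<phi> (?t i) (?t j) (?y i)
          = (?y j - ?y u - \<phi> (?t u) (?t j) (?y u)) + (?y u - z')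
            + (\<phi> (?t u) (?t j) (?y u) - \<phi> (?t u) (?t j) z')
            - (\<phi> (?t i) (?t j) (?y i) - \<phi> (?t i) (?t u) (?y i) - \<phi> (?t u) (?t j) z')"
        by (simp add: z'_def)
      also have "norm \<dots> \<le> M * r2 * (1 + norm (?y u)) + M * r1 * w + A * (M * r1 * w) + C * r * w"
        by (rule order_trans[OF norm_triangle_4 add_mono[OF add_mono[OF add_mono[OF J2 J1] L] D]])
      also have "\<dots> \<le> M * r2 * (q * w) + M * r1 * (q * w) + C * r * w"
      proof -
        have "(1 + A) * (M * r1 * w) \<le> q * (M * r1 * w)"
          using M(1) r(2) w by (intro mult_right_mono) (auto simp: q_def)
        moreover have "M * r2 * (1 + norm (?y u)) \<le> M * r2 * (q * w)"
          using yu M(1) r(3) by (intro mult_left_mono) auto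
        moreover have "q * (M * r1 * w) = M * r1 * (q * w)"
          by simp
        ultimately show ?thesis
          unfolding distrib_right mult_1_left by linarith
      qed
      also have "\<dots> = M * q * w * (r1 + r2) + C * r * w"
        by (simp add: algebra_simps)
      also have "\<dots> \<le> M * ((1 + \<kappa>) / (2 * \<kappa>)) * w * (\<kappa> * r) + C * r * w"
        using r \<tau>(3) w M(1) \<kappa>(1) C_nonneg
        by (intro add_mono[OF _ order_refl] mult_mono) (auto simp: q_def A_def)
      also have "\<dots> = (\<kappa> * M * ((1 + \<kappa>) / (2 * \<kappa>)) + C) * r * w"
        by (simp add: algebra_simps)
      finally show ?thesis
        unfolding M(2) by (simp add: r_def n_def w_def)
    qed
  qed
  show ?thesis
    using that M(1) \<tau>(1,2) bound by blast
qed

end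

section \<open>Paths that follow an almost flow\<close>

text \<open>A growth factor valid on every window of \<open>p\<close> steps is compounded once per window, so over \<open>N\<close> windows
  the total growth depends on \<open>N\<close> but not on \<open>p\<close>. This makes the bound on the Euler scheme uniform in the
  mesh.\<close>

lemma window_iteration:
  fixes w :: "nat \<Rightarrow> real"
  assumes B: "1 \<le> B" and w0: "0 \<le> w 0"
    and window: "\<And>i j. i \<le> j \<Longrightarrow> j \<le> N * p \<Longrightarrow> j - i \<le> p \<Longrightarrow> w j \<le> B * w i"
  shows "q \<le> N \<Longrightarrow> j \<le> q * p \<Longrightarrow> w j \<le> B ^ q * w 0"
proof (induction q arbitrary: j)
  case (Suc q)
  show ?case
  proof (cases "j \<le> q * p")
    case True
    then have "w j \<le> B ^ q * w 0"
      using Suc by simp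
    also have "\<dots> \<le> B ^ Suc q * w 0"
      using B w0 by (intro mult_right_mono power_increasing) auto
    finally show ?thesis .
  next
    case False
    have "Suc q * p \<le> N * p"
      using Suc.prems(1) by (rule mult_le_mono1)
    then have "w j \<le> B * w (q * p)"
      using False Suc.prems by (intro window) auto
    also have "\<dots> \<le> B * (B ^ q * w 0)"
      using B Suc by (intro mult_left_mono) auto
    finally show ?thesis
      by simp
  qed
qed simp

text \<open>By Tychonoff's theorem the sequence has a cluster point in the product of balls. Passing to a finer
  filter instead of a subsequence gives convergence at all points at once; limits of inequalities go through along \<open>F\<close> as they do along a sequence.\<close>

lemma bounded_functions_pointwise_cluster:
  fixes Y :: "nat \<Rightarrow> 'i \<Rightarrow> 'e::euclidean_space"
  assumes "\<And>n t. norm (Y n t) \<le> R"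
  obtains y F where "F \<le> sequentially" and "F \<noteq> bot" and "\<And>t. ((\<lambda>n. Y n t) \<longlongrightarrow> y t) F"
proof -
  have "compactin (product_topology (\<lambda>_. euclidean) UNIV) (PiE UNIV (\<lambda>_::'i. cball (0::'e) R))"
    by (simp add: compactin_PiE)
  then have "compact (PiE UNIV (\<lambda>_::'i. cball (0::'e) R))"
    by (simp add: euclidean_product_topology)
  moreover have "filtermap Y sequentially \<noteq> bot"
    by (simp add: filtermap_bot_iff)
  moreover have "eventually (\<lambda>f. f \<in> PiE UNIV (\<lambda>_. cball 0 R)) (filtermap Y sequentially)"
    using assms by (simp add: eventually_filtermap PiE_iff)
  ultimately obtain y where y: "inf (nhds y) (filtermap Y sequentially) \<noteq> bot"
    unfolding compact_filter by blast
  define F where "F = inf sequentially (filtercomap Y (nhds y))"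
  have "F \<noteq> bot"
  proof
    assume "F = bot"
    then have "eventually (\<lambda>_. False) F"
      by simp
    then obtain P Q where "eventually P sequentially" "eventually Q (nhds y)" "\<And>n. P n \<Longrightarrow> \<not> Q (Y n)"
      unfolding F_def eventually_inf eventually_filtercomap by blast
    then have "eventually Q (nhds y)" "eventually (\<lambda>f. \<not> Q f) (filtermap Y sequentially)"
      by (auto simp: eventually_filtermap elim: eventually_mono)
    then have "eventually (\<lambda>_. False) (inf (nhds y) (filtermap Y sequentially))"
      unfolding eventually_inf by blast
    then show False
      using y by (simp add: eventually_False)
  qed
  moreover have "(Y \<longlongrightarrow> y) F"
    unfolding F_def by (rule filterlim_mono[OF filterlim_filtercomap order_refl]) simp
  then have "((\<lambda>n. Y n t) \<longlongrightarrow> y t) F" for t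
    using continuous_on_tendsto_compose[OF continuous_on_product_coordinates] by fastforce
  ultimately show ?thesis
    using that[of F y] by (simp add: F_def)
qed

context almost_flow
begin

text \<open>On times up to \<open>1\<close> the powers of the time step are at most \<open>1\<close>, so the local error estimate bounds the
  growth of the scheme by a fixed factor.\<close>

lemma euler_local_growth:
  assumes "0 \<le> M" and "\<tau> \<le> 1" and "0 < h" and "i \<le> j" and "a + real j * h \<le> b" and "real (j - i) * h \<le> \<tau>"
    and error: "norm (euler h z j - euler h z i - \<phi> (a + real i * h) (a + real j * h) (euler h z i))
        \<le> M * (real (j - i) * h) powr \<theta> * (1 + norm (euler h z i))"
  shows "1 + norm (euler h z j) \<le> (1 + C + M) * (1 + norm (euler h z i))"
proof -
  let ?d = "real (j - i) * h"
  have d: "(a + real j * h) - (a + real i * h) = ?d" "0 \<le> ?d" "?d \<le> 1"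
    using assms by (auto simp: of_nat_diff algebra_simps)
  have le: "?d powr \<nu> \<le> 1" "?d powr \<theta> \<le> 1"
    using d \<nu>_pos \<theta>_gt_1 powr_mono2[of _ ?d 1] by auto
  have "norm (\<phi> (a + real i * h) (a + real j * h) (euler h z i)) \<le> C * ?d powr \<nu> * (1 + norm (euler h z i))"
    using growth[of "a + real i * h" "a + real j * h" "euler h z i", unfolded d] assms
    by (simp add: mult_right_mono)
  also have "\<dots> \<le> C * 1 * (1 + norm (euler h z i))"
    using le C_nonneg by (intro mult_right_mono mult_left_mono) auto
  finally have "norm (\<phi> (a + real i * h) (a + real j * h) (euler h z i)) \<le> C * (1 + norm (euler h z i))"
    by simp
  moreover have "M * ?d powr \<theta> * (1 + norm (euler h z i)) \<le> M * 1 * (1 + norm (euler h z i))"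
    using le assms(1) by (intro mult_right_mono mult_left_mono) auto
  moreover have "norm (euler h z j) \<le> norm (euler h z i) + norm (\<phi> (a + real i * h) (a + real j * h) (euler h z i))
      + norm (euler h z j - euler h z i - \<phi> (a + real i * h) (a + real j * h) (euler h z i))"
    using norm_triangle_ineq[of "euler h z i" "euler h z j - euler h z i"]
      norm_triangle_sub[of "euler h z j - euler h z i" "\<phi> (a + real i * h) (a + real j * h) (euler h z i)"]
    by simp
  ultimately have "1 + norm (euler h z j)
      \<le> (1 + norm (euler h z i)) + C * (1 + norm (euler h z i)) + M * (1 + norm (euler h z i))"
    using error by linarith
  then show ?thesis
    by (simp add: algebra_simps)
qed

text \<open>Existence of a path that follows the approximate flow up to order \<open>\<theta>\<close>. The meshes \<open>h n\<close> subdivide each of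
  \<open>N\<close> equal windows of length at most \<open>\<tau>\<close> into \<open>Suc n\<close> cells, which makes the iteration over windows exact.
  The piecewise constant interpolations of the Euler schemes are then uniformly bounded, and a pointwise
  cluster point \<open>y\<close> inherits the local error estimate. For \<open>t - s \<ge> \<tau>\<close> the estimate only says that \<open>y\<close> is
  bounded.\<close>

theorem davie_path_exists:
  assumes "a \<le> b"
  obtains y K where "y a = z" and "0 \<le> K"
    and "\<And>s t. a \<le> s \<Longrightarrow> s \<le> t \<Longrightarrow> t \<le> b \<Longrightarrow> norm (y t - y s - \<phi> s t (y s)) \<le> K * (t - s) powr \<theta>"
proof (cases "a = b")
  case True
  have "norm (z - z - \<phi> s t z) \<le> 0 * (t - s) powr \<theta>" if "a \<le> s" "s \<le> t" "t \<le> b" for s t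
  proof -
    have "s = t"
      using that True by simp
    then show ?thesis
      using \<phi>_refl[of s] that by simp
  qed
  then show ?thesis
    by (intro that[of "\<lambda>_. z" 0]) auto
next
  case False
  then have "a < b"
    using assms by simp
  obtain M \<tau> where M: "0 \<le> M" and \<tau>: "0 < \<tau>" "\<tau> \<le> 1" and err:
    "\<And>h z i j. 0 < h \<Longrightarrow> i \<le> j \<Longrightarrow> a + real j * h \<le> b \<Longrightarrow> real (j - i) * h \<le> \<tau> \<Longrightarrow>
      norm (euler h z j - euler h z i - \<phi> (a + real i * h) (a + real j * h) (euler h z i))
        \<le> M * (real (j - i) * h) powr \<theta> * (1 + norm (euler h z i))"
    by (rule euler_local_error) blast
  define T where "T = b - a"
  have T: "0 < T" using \<open>a < b\<close> by (simp add: T_def)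
  define N where "N = nat \<lceil>T / \<tau>\<rceil>"
  have "T / \<tau> \<le> real N"
    by (simp add: N_def of_nat_ceiling)
  moreover have "0 < T / \<tau>"
    using T \<tau> by simp
  ultimately have "0 < real N"
    by linarith
  then have N: "0 < real N" "T / N \<le> \<tau>"
    using \<open>T / \<tau> \<le> real N\<close> \<tau> by (auto simp: field_simps)
  define h where "h n = T / (real N * real (Suc n))" for n
  have h: "0 < h n" "real (Suc n) * h n \<le> \<tau>" "real (N * Suc n) * h n = T" for n
    using T N by (simp_all add: h_def del: of_nat_Suc mult_Suc_right)
  have h_lim: "h \<longlonglongrightarrow> 0"
    unfolding h_def using N tendsto_mult[OF tendsto_const[of "T / N"] LIMSEQ_inverse_real_of_nat]
    by (simp add: divide_inverse mult.assoc)
  \<comment> \<open>The index of the last grid point up to \<open>t\<close>; the minimum keeps \<open>Y n\<close> bounded outside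
    of \<open>{a..b}\<close>.\<close>
  define idx where "idx n t = min (N * Suc n) (nat \<lfloor>(t - a) / h n\<rfloor>)" for n t
  define p where "p n t = a + real (idx n t) * h n" for n t
  define Y where "Y n t = euler (h n) z (idx n t)" for n t
  have end_le: "a + real j * h n \<le> b" if "j \<le> N * Suc n" for n j
  proof -
    have "real j * h n \<le> real (N * Suc n) * h n"
      by (rule mult_right_mono[OF of_nat_mono[OF that] less_imp_le[OF h(1)]])
    then show ?thesis
      unfolding h(3) by (simp add: T_def)
  qed
  have idx_eq: "idx n t = nat \<lfloor>(t - a) / h n\<rfloor>" if "a \<le> t" "t \<le> b" for n t
  proof -
    have "(t - a) / h n \<le> real (N * Suc n)"
      unfolding pos_divide_le_eq[OF h(1)] h(3) using that by (simp add: T_def)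
    then have "nat \<lfloor>(t - a) / h n\<rfloor> \<le> N * Suc n"
      by linarith
    then show ?thesis
      by (simp add: idx_def)
  qed
  have p: "p n t \<le> t" "t \<le> p n t + h n" if "a \<le> t" "t \<le> b" for n t
  proof -
    have "0 \<le> (t - a) / h n"
      using that h(1)[of n] by simp
    then have "real (idx n t) \<le> (t - a) / h n" "(t - a) / h n \<le> real (idx n t) + 1"
      unfolding idx_eq[OF that] by linarith+
    then show "p n t \<le> t" "t \<le> p n t + h n"
      using h(1)[of n] by (auto simp: p_def field_simps)
  qed
  have p_range: "a \<le> p n t" "p n t \<le> b" for n t
    unfolding p_def using h(1)[of n] end_le[of "idx n t" n] by (auto simp: idx_def less_imp_le)
  have p_lim: "(\<lambda>n. p n t) \<longlonglongrightarrow> t" if "a \<le> t" "t \<le> b" for t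
  proof (rule tendsto_sandwich)
    show "(\<lambda>n. t - h n) \<longlonglongrightarrow> t"
      using tendsto_diff[OF tendsto_const h_lim, of t] by simp
  qed (use p[OF that] in \<open>auto simp: algebra_simps\<close>)
  define R where "R = (1 + C + M) ^ N * (1 + norm z)"
  have euler_R: "1 + norm (euler (h n) z j) \<le> R" if "j \<le> N * Suc n" for n j
  proof -
    have "1 + norm (euler (h n) z j) \<le> (1 + C + M) ^ N * (1 + norm (euler (h n) z 0))"
    proof (rule window_iteration[where N = N and p = "Suc n"])
      fix i j assume ij: "i \<le> j" "j \<le> N * Suc n" "j - i \<le> Suc n"
      have "real (j - i) * h n \<le> real (Suc n) * h n"
        using ij h(1)[of n] by (intro mult_right_mono) auto
      then have "real (j - i) * h n \<le> \<tau>"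
        using h(2)[of n] by linarith
      then show "1 + norm (euler (h n) z j) \<le> (1 + C + M) * (1 + norm (euler (h n) z i))"
        using euler_local_growth[OF M \<tau>(2) h(1) ij(1) end_le[OF ij(2)]] err[OF h(1) ij(1) end_le[OF ij(2)]]
        by blast
    qed (use that C_nonneg M in auto)
    then show ?thesis
      by (simp add: R_def)
  qed
  have Y_R: "1 + norm (Y n t) \<le> R" for n t
    unfolding Y_def by (rule euler_R) (simp add: idx_def)
  then have "norm (Y n t) \<le> R" for n t
    using Y_R[of n t] by linarith
  then obtain y F where F: "F \<le> sequentially" "F \<noteq> bot" and lim: "\<And>t. ((\<lambda>n. Y n t) \<longlongrightarrow> y t) F"
    by (rule bounded_functions_pointwise_cluster[where Y=Y and R=R]) blast
  have y_R: "1 + norm (y t) \<le> R" for t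
    using lim[of t] F Y_R by (intro tendsto_upperbound[of "\<lambda>n. 1 + norm (Y n t)"] tendsto_intros always_eventually) auto
  have Ya: "Y n a = z" for n
    using assms by (simp add: Y_def idx_def)
  have "y a = z"
    using lim[of a] F by (simp add: Ya tendsto_const_iff)
  have "0 \<le> R"
    using y_R[of a] norm_ge_zero[of "y a"] by linarith
  have near: "norm (y t - y s - \<phi> s t (y s)) \<le> M * R * (t - s) powr \<theta>"
    if st: "a \<le> s" "s \<le> t" "t \<le> b" "t - s < \<tau>" for s t
  proof -
    have s: "a \<le> s" "s \<le> b" and t: "a \<le> t" "t \<le> b"
      using st by auto
    have idx_mono: "idx n s \<le> idx n t" for n
      unfolding idx_def using st h(1)[of n]
      by (intro min.mono nat_mono floor_mono divide_right_mono order_refl) auto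
    have p_mono: "p n s \<le> p n t" for n
      using idx_mono[of n] h(1)[of n] by (simp add: p_def)
    have ps: "((\<lambda>n. p n s) \<longlongrightarrow> s) F" and pt: "((\<lambda>n. p n t) \<longlongrightarrow> t) F"
      using p_lim[OF s] p_lim[OF t] F(1) by (auto intro: tendsto_mono)
    have "((\<lambda>n. \<phi> (p n s) (p n t) (y s)) \<longlongrightarrow> \<phi> s t (y s)) F"
      using continuous_on_tendsto_compose[OF continuous[of "y s"] tendsto_Pair[OF ps pt]] s t p_range
      by simp
    moreover have "((\<lambda>n. \<phi> (p n s) (p n t) (Y n s) - \<phi> (p n s) (p n t) (y s)) \<longlongrightarrow> 0) F"
    proof (rule Lim_null_comparison)
      have "norm (\<phi> (p n s) (p n t) (Y n s) - \<phi> (p n s) (p n t) (y s)) \<le> C * T powr \<nu> * norm (Y n s - y s)" for n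
      proof -
        have "norm (\<phi> (p n s) (p n t) (Y n s) - \<phi> (p n s) (p n t) (y s)) \<le> C * (p n t - p n s) powr \<nu> * norm (Y n s - y s)"
          using p_range p_mono by (intro lipschitz) auto
        also have "\<dots> \<le> C * T powr \<nu> * norm (Y n s - y s)"
          using p_range[of n s] p_range[of n t] p_mono[of n] C_nonneg \<nu>_pos
          by (intro mult_right_mono mult_left_mono powr_mono2) (auto simp: T_def)
        finally show ?thesis .
      qed
      then show "\<forall>\<^sub>F n in F. norm (\<phi> (p n s) (p n t) (Y n s) - \<phi> (p n s) (p n t) (y s)) \<le> C * T powr \<nu> * norm (Y n s - y s)"
        by (simp add: always_eventually)
      show "((\<lambda>n. C * T powr \<nu> * norm (Y n s - y s)) \<longlongrightarrow> 0) F"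
        using tendsto_mult[OF tendsto_const tendsto_norm_zero[OF LIM_zero[OF lim]]] by fastforce
    qed
    ultimately have "((\<lambda>n. \<phi> (p n s) (p n t) (Y n s)) \<longlongrightarrow> \<phi> s t (y s)) F"
      using tendsto_add by fastforce
    then have "((\<lambda>n. norm (Y n t - Y n s - \<phi> (p n s) (p n t) (Y n s))) \<longlongrightarrow> norm (y t - y s - \<phi> s t (y s))) F"
      by (intro tendsto_intros lim)
    moreover have "((\<lambda>n. M * R * (p n t - p n s) powr \<theta>) \<longlongrightarrow> M * R * (t - s) powr \<theta>) F"
      using \<theta>_gt_1 p_mono by (intro tendsto_intros tendsto_powr2 ps pt) auto
    moreover have "\<forall>\<^sub>F n in F. norm (Y n t - Y n s - \<phi> (p n s) (p n t) (Y n s)) \<le> M * R * (p n t - p n s) powr \<theta>"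
    proof -
      have "\<forall>\<^sub>F n in F. p n t - p n s < \<tau>"
        using order_tendstoD(2)[OF tendsto_diff[OF pt ps]] st by blast
      then show ?thesis
      proof (rule eventually_mono)
        fix n assume n: "p n t - p n s < \<tau>"
        have d: "real (idx n t - idx n s) * h n = p n t - p n s"
          using idx_mono[of n] by (simp add: p_def of_nat_diff algebra_simps)
        have "norm (Y n t - Y n s - \<phi> (p n s) (p n t) (Y n s)) \<le> M * (p n t - p n s) powr \<theta> * (1 + norm (Y n s))"
          using err[OF h(1)[of n] idx_mono[of n] end_le[of "idx n t" n], of z] n
          unfolding d Y_def p_def[symmetric] by (simp add: idx_def)
        also have "\<dots> \<le> M * (p n t - p n s) powr \<theta> * R"
          using M Y_R by (intro mult_left_mono) auto
        finally show "norm (Y n t - Y n s - \<phi> (p n s) (p n t) (Y n s)) \<le> M * R * (p n t - p n s) powr \<theta>"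
          by (simp add: mult_ac)
      qed
    qed
    ultimately show ?thesis
      using tendsto_le[OF F(2)] by blast
  qed
  define D where "D = (2 * R + C * T powr \<nu> * R) / \<tau> powr \<theta>"
  have D: "0 \<le> D"
    using \<open>0 \<le> R\<close> C_nonneg by (simp add: D_def)
  have far: "norm (y t - y s - \<phi> s t (y s)) \<le> D * (t - s) powr \<theta>"
    if st: "a \<le> s" "s \<le> t" "t \<le> b" "\<tau> \<le> t - s" for s t
  proof -
    have "norm (\<phi> s t (y s)) \<le> C * (t - s) powr \<nu> * (1 + norm (y s))"
      using st by (intro growth)
    also have "\<dots> \<le> C * T powr \<nu> * R"
      using st C_nonneg \<nu>_pos y_R by (intro mult_mono powr_mono2) (auto simp: T_def)
    finally have "norm (y t - y s - \<phi> s t (y s)) \<le> 2 * R + C * T powr \<nu> * R"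
      using y_R[of t] y_R[of s] norm_triangle_ineq4[of "y t - y s" "\<phi> s t (y s)"] norm_triangle_ineq4[of "y t" "y s"]
      by linarith
    also have "\<dots> = D * \<tau> powr \<theta>"
      using \<tau> by (simp add: D_def)
    also have "\<dots> \<le> D * (t - s) powr \<theta>"
      using st \<tau> \<theta>_gt_1 D by (intro mult_left_mono powr_mono2) auto
    finally show ?thesis .
  qed
  show ?thesis
  proof (rule that[of y "M * R + D"])
    fix s t assume st: "a \<le> s" "s \<le> t" "t \<le> b"
    have "0 \<le> M * R"
      using M \<open>0 \<le> R\<close> by simp
    then have "M * R * (t - s) powr \<theta> \<le> (M * R + D) * (t - s) powr \<theta>" "D * (t - s) powr \<theta> \<le> (M * R + D) * (t - s) powr \<theta>"
      using D by (auto intro!: mult_right_mono)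
    then show "norm (y t - y s - \<phi> s t (y s)) \<le> (M * R + D) * (t - s) powr \<theta>"
      using near[OF st] far[OF st] by (cases "t - s < \<tau>") auto
  qed (use \<open>y a = z\<close> M D \<open>0 \<le> R\<close> in auto)
qed

end

section \<open>Hoelder estimates for rough paths and coefficients\<close>

lemma powr_le_powr_lower_exponent:
  fixes d T :: real
  assumes "0 \<le> d" and "d \<le> T" and "\<beta> \<le> \<gamma>"
  shows "d powr \<gamma> \<le> T powr (\<gamma> - \<beta>) * d powr \<beta>"
proof -
  have "d powr \<gamma> = d powr (\<gamma> - \<beta>) * d powr \<beta>"
    by (simp flip: powr_add)
  also have "\<dots> \<le> T powr (\<gamma> - \<beta>) * d powr \<beta>"
    using assms by (intro mult_right_mono powr_mono2) auto
  finally show ?thesis .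
qed

lemma powr_double: "(d::real) powr (2 * \<nu>) = (d powr \<nu>)\<^sup>2"
  using powr_add[of d \<nu> \<nu>] by (simp add: power2_eq_square)

lemma powr_triple: "(d::real) powr (3 * \<nu>) = (d powr \<nu>) ^ 3"
  using powr_add[of d "2 * \<nu>" \<nu>] by (simp add: powr_double power3_eq_cube power2_eq_square)

lemma holder_path_imp_continuous_on:
  assumes "holder_path \<nu> I y" and "0 < \<nu>"
  shows "continuous_on I y"
  unfolding continuous_on_def
proof
  fix s assume s: "s \<in> I"
  obtain C where C: "\<And>t. t \<in> I \<Longrightarrow> norm (y t - y s) \<le> C * \<bar>t - s\<bar> powr \<nu>"
    using assms(1) s unfolding holder_path_def by blast
  have "((\<lambda>t. y t - y s) \<longlongrightarrow> 0) (at s within I)"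
  proof (rule Lim_null_comparison)
    show "\<forall>\<^sub>F t in at s within I. norm (y t - y s) \<le> C * \<bar>t - s\<bar> powr \<nu>"
      using C by (auto simp: eventually_at_filter)
    have "((\<lambda>t. C * \<bar>t - s\<bar> powr \<nu>) \<longlongrightarrow> C * \<bar>s - s\<bar> powr \<nu>) (at s within I)"
      using assms(2) by (intro tendsto_intros tendsto_powr2) auto
    then show "((\<lambda>t. C * \<bar>t - s\<bar> powr \<nu>) \<longlongrightarrow> 0) (at s within I)"
      by simp
  qed
  then show "(y \<longlongrightarrow> y s) (at s within I)"
    by (simp add: LIM_zero_iff)
qed

text \<open>All increments are measured in powers of \<open>r = (t - s) powr \<nu>\<close>: the path is of order \<open>r\<close>, and the second level
  and, because of \<open>\<nu> < 1 / 2\<close> and the bounded interval, time itself are of order \<open>r\<^sup>2\<close>. The estimates below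
  then reduce to counting powers of \<open>r\<close>.\<close>

lemma rough_path_bounds:
  assumes "rough_path \<nu> {a..b} x X" and "\<nu> < 1 / 2" and "0 < \<nu>"
  obtains H where "0 \<le> H"
    and "\<And>s t. a \<le> s \<Longrightarrow> s \<le> t \<Longrightarrow> t \<le> b \<Longrightarrow> (t - s) powr \<nu> \<le> H"
    and "\<And>s t. a \<le> s \<Longrightarrow> s \<le> t \<Longrightarrow> t \<le> b \<Longrightarrow> t - s \<le> H * ((t - s) powr \<nu>)\<^sup>2"
    and "\<And>s t. a \<le> s \<Longrightarrow> s \<le> t \<Longrightarrow> t \<le> b \<Longrightarrow> norm (x t - x s) \<le> H * (t - s) powr \<nu>"
    and "\<And>s t. a \<le> s \<Longrightarrow> s \<le> t \<Longrightarrow> t \<le> b \<Longrightarrow> norm (X s t) \<le> H * ((t - s) powr \<nu>)\<^sup>2"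
proof -
  obtain C1 where C1: "\<And>s t. s \<in> {a..b} \<Longrightarrow> t \<in> {a..b} \<Longrightarrow> norm (x t - x s) \<le> C1 * \<bar>t - s\<bar> powr \<nu>"
    using assms(1) unfolding rough_path_def holder_path_def by blast
  obtain C2 where C2: "\<And>s t. s \<in> {a..b} \<Longrightarrow> t \<in> {a..b} \<Longrightarrow> s < t \<Longrightarrow> norm (X s t) \<le> C2 * \<bar>t - s\<bar> powr (2 * \<nu>)"
    using assms(1) unfolding rough_path_def holder_two_param_def by blast
  have X_refl: "X s s = 0" if "s \<in> {a..b}" for s
  proof -
    have "X s s - X s s - X s s = tensor (x s - x s) (x s - x s)"
      using assms(1) that unfolding rough_path_def by blast
    then show ?thesis
      by (simp add: tensor_def vec_eq_iff)
  qed
  define H where "H = Max {0, C1, C2, (b - a) powr \<nu>, (b - a) powr (1 - 2 * \<nu>)}"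
  have H: "0 \<le> H" "C1 \<le> H" "C2 \<le> H" "(b - a) powr \<nu> \<le> H" "(b - a) powr (1 - 2 * \<nu>) \<le> H"
    by (simp_all add: H_def)
  have up: "p \<le> H * q" if "p \<le> k * q" and "k \<le> H" and "0 \<le> q" for p q k
    using that(1) mult_right_mono[OF that(2,3)] by (rule order_trans)
  show ?thesis
  proof (rule that[OF H(1)])
    fix s t assume st: "a \<le> s" "s \<le> t" "t \<le> b"
    have "(t - s) powr \<nu> \<le> (b - a) powr \<nu>"
      using st assms by (intro powr_mono2) auto
    then show "(t - s) powr \<nu> \<le> H"
      using H by simp
    have "t - s \<le> (b - a) powr (1 - 2 * \<nu>) * (t - s) powr (2 * \<nu>)"
      using powr_le_powr_lower_exponent[of "t - s" "b - a" "2 * \<nu>" 1] st assms by simp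
    then show "t - s \<le> H * ((t - s) powr \<nu>)\<^sup>2"
      unfolding powr_double using H(5) by (rule up) simp
    show "norm (x t - x s) \<le> H * (t - s) powr \<nu>"
      using C1[of s t] st by (intro up[OF _ H(2)]) auto
    show "norm (X s t) \<le> H * ((t - s) powr \<nu>)\<^sup>2"
    proof (cases "s = t")
      case True
      then show ?thesis
        using X_refl st by simp
    next
      case False
      then show ?thesis
        using C2[of s t] st by (intro up[OF _ H(3)]) (auto simp: powr_double)
    qed
  qed
qed

lemma norm_diff_le_of_fderiv_bound:
  assumes "\<And>z. g differentiable (at z)" and "\<And>z. norm (fderiv g z) \<le> K"
  shows "norm (g z - g w) \<le> K * norm (z - w)"
proof (rule differentiable_bound[where S = UNIV])
  fix u
  show "(g has_derivative blinfun_apply (fderiv g u)) (at u within UNIV)"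
    using has_derivative_fderiv[OF assms(1)] by simp
  show "onorm (blinfun_apply (fderiv g u)) \<le> K"
    using assms(2) by (simp flip: norm_blinfun.rep_eq)
qed auto

text \<open>One constant that serves as a bound of \<open>g\<close> and of its derivatives up to order two, hence as a Lipschitz
  constant of \<open>g\<close> and its derivative, and as the constant of the second order Taylor remainder.\<close>

lemma C3b_bounds:
  assumes "C3b g"
  obtains K where "0 \<le> K" and "\<And>z. norm (g z) \<le> K" and "\<And>z. norm (fderiv g z) \<le> K"
    and "\<And>z w. norm (g z - g w) \<le> K * norm (z - w)"
    and "\<And>z w. norm (fderiv g z - fderiv g w) \<le> K * norm (z - w)"
    and "\<And>z w. norm (g (z + w) - g z - fderiv g z w) \<le> K * (norm w)\<^sup>2"
proof -
  obtain K0 K1 K2 where K012: "\<And>z. norm (g z) \<le> K0" "\<And>z. norm (fderiv g z) \<le> K1"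
      "\<And>z. norm (fderiv (fderiv g) z) \<le> K2"
    using assms unfolding C3b_def bounded_iff by (metis rangeI)
  define K where "K = Max {0, K0, K1, K2}"
  have K: "0 \<le> K" "norm (g z) \<le> K" "norm (fderiv g z) \<le> K" "norm (fderiv (fderiv g) z) \<le> K" for z
    using K012[of z] by (auto simp: K_def)
  have diff: "g differentiable (at z)" "fderiv g differentiable (at z)" for z
    using assms by (auto simp: C3b_def)
  have lip: "norm (fderiv g z - fderiv g w) \<le> K * norm (z - w)" for z w
    using diff K by (intro norm_diff_le_of_fderiv_bound)
  have taylor: "norm (g (z + w) - g z - fderiv g z w) \<le> K * (norm w)\<^sup>2" for z w
  proof -
    have "norm (g (z + w) - g z - fderiv g z ((z + w) - z)) \<le> norm ((z + w) - z) * (K * norm w)"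
    proof (rule differentiable_bound_linearization[where S = "cball z (norm w)" and f' = "\<lambda>u. blinfun_apply (fderiv g u)"])
      fix u assume "u \<in> cball z (norm w)"
      then have u: "norm (u - z) \<le> norm w"
        by (simp add: dist_norm norm_minus_commute)
      show "(g has_derivative blinfun_apply (fderiv g u)) (at u within cball z (norm w))"
        by (rule has_derivative_at_withinI[OF has_derivative_fderiv[OF diff(1)]])
      have "onorm (blinfun_apply (fderiv g u) - blinfun_apply (fderiv g z)) = norm (fderiv g u - fderiv g z)"
        by (simp add: norm_blinfun.rep_eq minus_blinfun.rep_eq fun_diff_def)
      also have "\<dots> \<le> K * norm w"
        using lip[of u z] mult_left_mono[OF u K(1)] by linarith
      finally show "onorm (blinfun_apply (fderiv g u) - blinfun_apply (fderiv g z)) \<le> K * norm w" .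
    next
      fix c :: real assume "c \<in> {0..1}"
      then show "z + c *\<^sub>R ((z + w) - z) \<in> cball z (norm w)"
        by (simp add: dist_norm mult_left_le_one_le)
    qed simp
    then show ?thesis
      by (simp add: power2_eq_square mult_ac)
  qed
  show ?thesis
    using that[OF K(1,2,3) norm_diff_le_of_fderiv_bound[OF diff(1) K(3)] lip taylor] by blast
qed

lemma norm_compose_fderiv_diff_le:
  fixes g :: "'a::real_normed_vector \<Rightarrow> 'u::real_normed_vector \<Rightarrow>\<^sub>L 'a"
  assumes "0 \<le> K" and "\<And>z. norm (g z) \<le> K" and "\<And>z. norm (fderiv g z) \<le> K"
    and "\<And>z w. norm (g z - g w) \<le> K * norm (z - w)"
    and "\<And>z w. norm (fderiv g z - fderiv g w) \<le> K * norm (z - w)"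
  shows "norm ((fderiv g z o\<^sub>L g z) - (fderiv g w o\<^sub>L g w)) \<le> 2 * K\<^sup>2 * norm (z - w)"
proof -
  have "(fderiv g z o\<^sub>L g z) - (fderiv g w o\<^sub>L g w)
      = ((fderiv g z - fderiv g w) o\<^sub>L g z) + (fderiv g w o\<^sub>L (g z - g w))"
    by (intro blinfun_eqI) (simp add: blinfun.bilinear_simps)
  also have "norm \<dots> \<le> norm (fderiv g z - fderiv g w) * norm (g z) + norm (fderiv g w) * norm (g z - g w)"
    by (intro norm_triangle_mono norm_blinfun_compose)
  also have "\<dots> \<le> (K * norm (z - w)) * K + K * (K * norm (z - w))"
    using assms by (intro add_mono mult_mono) auto
  finally show ?thesis
    by (simp add: power2_eq_square algebra_simps)
qed

lemma tensor_apply_diff_left: "tensor_apply (A - B) M = tensor_apply A M - tensor_apply B M"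
  by (simp add: tensor_apply_def blinfun.diff_left scaleR_diff_right sum_subtractf)

lemma norm_tensor_apply_le:
  fixes A :: "(real ^ 'm) \<Rightarrow>\<^sub>L (real ^ 'm) \<Rightarrow>\<^sub>L 'w::real_normed_vector"
  shows "norm (tensor_apply A M) \<le> (real CARD('m))\<^sup>2 * norm A * norm M"
proof -
  have "norm ((M $ i $ j) *\<^sub>R blinfun_apply (blinfun_apply A (axis i 1)) (axis j 1)) \<le> norm A * norm M" for i j
  proof -
    have "norm (blinfun_apply A (axis i 1)) \<le> norm A"
      using norm_blinfun[of A "axis i 1"] by simp
    then have "norm (blinfun_apply (blinfun_apply A (axis i 1)) (axis j 1)) \<le> norm A"
      using norm_blinfun[of "blinfun_apply A (axis i 1)" "axis j 1"] by simp
    moreover have "\<bar>M $ i $ j\<bar> \<le> norm M"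
      using component_le_norm_cart[of "M $ i" j] Finite_Cartesian_Product.norm_nth_le[of M i] by linarith
    ultimately show ?thesis
      using mult_mono[of "\<bar>M $ i $ j\<bar>" "norm M" "norm (blinfun_apply (blinfun_apply A (axis i 1)) (axis j 1))" "norm A"]
      by (simp add: mult.commute)
  qed
  then have "norm (tensor_apply A M) \<le> (\<Sum>i\<in>(UNIV::'m set). \<Sum>j\<in>(UNIV::'m set). norm A * norm M)"
    unfolding tensor_apply_def by (intro sum_norm_le)
  then show ?thesis
    by (simp add: power2_eq_square mult_ac)
qed

section \<open>The almost flow of a rough differential equation\<close>

text \<open>The second order Euler increment proposed by Davie, with the drift added.\<close>

definition rde_step ::
  "(real \<Rightarrow> real ^ 'm) \<Rightarrow> (real \<Rightarrow> real \<Rightarrow> real ^ 'm ^ 'm) \<Rightarrow>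
   (real ^ 'd \<Rightarrow> real ^ 'd) \<Rightarrow> (real ^ 'd \<Rightarrow> (real ^ 'm) \<Rightarrow>\<^sub>L (real ^ 'd)) \<Rightarrow>
   real \<Rightarrow> real \<Rightarrow> real ^ 'd \<Rightarrow> real ^ 'd" where
  "rde_step x X f g s t z =
     (t - s) *\<^sub>R f z + g z (x t - x s) + tensor_apply (fderiv g z o\<^sub>L g z) (X s t)"

text \<open>The algebra behind the defect estimate. Chen's relation produces the term
  \<open>tensor (x u - x s) (x t - x u)\<close>, which the second level coefficient \<open>fderiv g z o\<^sub>L g z\<close> turns into
  \<open>fderiv g z w (x t - x u)\<close>; this is the linear part of \<open>g z' - g z\<close> applied to \<open>x t - x u\<close>. The increment
  of \<open>g\<close> from \<open>z\<close> to \<open>z'\<close> is split at \<open>z + w\<close>, so that the quadratic Taylor remainder is applied to the bounded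
  increment \<open>w\<close> alone and the remaining displacement, which contains the unbounded drift \<open>f\<close>, enters linearly.\<close>

lemma rde_step_defect_eq:
  fixes x f g s u z
  assumes "X s t - X s u - X u t = tensor (x u - x s) (x t - x u)"
  defines "w \<equiv> blinfun_apply (g z) (x u - x s)"
    and "z' \<equiv> z + rde_step x X f g s u z"
  shows "rde_step x X f g s t z - rde_step x X f g s u z - rde_step x X f g u t z'
    = (t - u) *\<^sub>R (f z - f z')
      + tensor_apply ((fderiv g z o\<^sub>L g z) - (fderiv g z' o\<^sub>L g z')) (X u t)
      - (g z' - g (z + w)) (x t - x u)
      - (g (z + w) - g z - fderiv g z w) (x t - x u)"
proof -
  interpret T: linear "tensor_apply A" for A :: "(real ^ 'a) \<Rightarrow>\<^sub>L (real ^ 'a) \<Rightarrow>\<^sub>L (real ^ 'b)"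
    by (rule linear_tensor_apply)
  have X: "X s t = X s u + X u t + tensor (x u - x s) (x t - x u)"
    using assms(1) by (simp add: algebra_simps)
  have x: "x t - x s = (x u - x s) + (x t - x u)"
    by simp
  have eq1: "rde_step x X f g s t z = (t - s) *\<^sub>R f z + w + g z (x t - x u)
      + tensor_apply (fderiv g z o\<^sub>L g z) (X s u) + tensor_apply (fderiv g z o\<^sub>L g z) (X u t)
      + fderiv g z w (x t - x u)"
    unfolding rde_step_def X T.add tensor_apply_tensor x blinfun.add_right w_def by simp
  have eq2: "rde_step x X f g s u z = (u - s) *\<^sub>R f z + w + tensor_apply (fderiv g z o\<^sub>L g z) (X s u)"
    by (simp add: rde_step_def w_def)
  have eq3: "rde_step x X f g u t z' = (t - u) *\<^sub>R f z' + g z' (x t - x u)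
      + tensor_apply (fderiv g z' o\<^sub>L g z') (X u t)"
    by (simp add: rde_step_def)
  show ?thesis
    unfolding eq1 eq2 eq3
    by (simp add: tensor_apply_diff_left blinfun.diff_left blinfun.add_left algebra_simps)
qed

text \<open>Each of the four terms of the defect is of order \<open>r ^ 3 = (t - s) powr (3 * \<nu>)\<close>, and grows at most linearly in
  \<open>z\<close>: the drift only enters linearly, since \<open>g\<close> is bounded and since the Taylor remainder is taken along \<open>w\<close>.\<close>

lemma rde_step_almost_flow:
  fixes x :: "real \<Rightarrow> real ^ 'm" and f :: "real ^ 'd \<Rightarrow> real ^ 'd"
  assumes rp: "rough_path \<nu> {a..b} x X" and \<nu>: "1 / 3 < \<nu>" "\<nu> < 1 / 2"
    and f: "L-lipschitz_on UNIV f" and g: "C3b g"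
  obtains C where "almost_flow (rde_step x X f g) a b C \<nu> (3 * \<nu>)"
proof -
  obtain H where H: "0 \<le> H"
    and r_H: "\<And>s t. a \<le> s \<Longrightarrow> s \<le> t \<Longrightarrow> t \<le> b \<Longrightarrow> (t - s) powr \<nu> \<le> H"
    and t_H: "\<And>s t. a \<le> s \<Longrightarrow> s \<le> t \<Longrightarrow> t \<le> b \<Longrightarrow> t - s \<le> H * ((t - s) powr \<nu>)\<^sup>2"
    and x_H: "\<And>s t. a \<le> s \<Longrightarrow> s \<le> t \<Longrightarrow> t \<le> b \<Longrightarrow> norm (x t - x s) \<le> H * (t - s) powr \<nu>"
    and X_H: "\<And>s t. a \<le> s \<Longrightarrow> s \<le> t \<Longrightarrow> t \<le> b \<Longrightarrow> norm (X s t) \<le> H * ((t - s) powr \<nu>)\<^sup>2"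
    by (rule rough_path_bounds[OF rp \<nu>(2)]) (use \<nu>(1) in auto)
  obtain K where K: "0 \<le> K" "\<And>z. norm (g z) \<le> K" "\<And>z. norm (fderiv g z) \<le> K"
    and g_lip: "\<And>z w. norm (g z - g w) \<le> K * norm (z - w)"
    and dg_lip: "\<And>z w. norm (fderiv g z - fderiv g w) \<le> K * norm (z - w)"
    and taylor: "\<And>z w. norm (g (z + w) - g z - fderiv g z w) \<le> K * (norm w)\<^sup>2"
    by (rule C3b_bounds[OF g]) blast
  define G where "G z = fderiv g z o\<^sub>L g z" for z
  have G_lip: "norm (G z - G w) \<le> 2 * K\<^sup>2 * norm (z - w)" for z w
    unfolding G_def using K g_lip dg_lip by (rule norm_compose_fderiv_diff_le)
  have G_K: "norm (G z) \<le> K\<^sup>2" for z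
    unfolding G_def power2_eq_square using K by (intro order_trans[OF norm_blinfun_compose] mult_mono) auto
  define c where "c = (real CARD('m))\<^sup>2"
  have "0 \<le> c"
    by (simp add: c_def)
  have TA: "norm (tensor_apply A M) \<le> c * p * q" if "norm A \<le> p" "norm M \<le> q"
    for A :: "(real ^ 'm) \<Rightarrow>\<^sub>L (real ^ 'm) \<Rightarrow>\<^sub>L (real ^ 'd)" and M p q
    using that order_trans[OF norm_ge_zero that(1)] \<open>0 \<le> c\<close> unfolding c_def
    by (intro order_trans[OF norm_tensor_apply_le] mult_mono) auto
  have L: "0 \<le> L"
    using lipschitz_on_nonneg[OF f] .
  have f_lip: "norm (f z - f w) \<le> L * norm (z - w)" for z w
    using lipschitz_onD[OF f, of z w] by (simp add: dist_norm)
  define E where "E = norm (f 0) + L"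
  have E: "0 \<le> E"
    using L by (simp add: E_def)
  have f_growth: "norm (f z) \<le> E * (1 + norm z)" for z
  proof -
    have "norm (f z) \<le> norm (f 0) + L * norm z"
      using f_lip[of z 0] norm_triangle_sub[of "f z" "f 0"] by simp
    also have "\<dots> \<le> E * (1 + norm z)"
      using L by (simp add: E_def algebra_simps)
    finally show ?thesis .
  qed
  let ?\<phi> = "rde_step x X f g"
  have \<phi>_eq: "?\<phi> s t z = (t - s) *\<^sub>R f z + g z (x t - x s) + tensor_apply (G z) (X s t)" for s t z
    by (simp add: rde_step_def G_def)
  \<comment> \<open>Drift and second level part are both of order \<open>r\<^sup>2\<close>.\<close>
  have second_order: "norm (?\<phi> s t z - g z (x t - x s)) \<le> (H * E + c * K\<^sup>2 * H) * ((t - s) powr \<nu>)\<^sup>2 * (1 + norm z)"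
    if st: "a \<le> s" "s \<le> t" "t \<le> b" for s t z
  proof -
    define r where "r = (t - s) powr \<nu>"
    have "norm ((t - s) *\<^sub>R f z) \<le> (H * r\<^sup>2) * (E * (1 + norm z))"
      using t_H[OF st] f_growth[of z] st unfolding norm_scaleR r_def by (intro mult_mono) auto
    moreover have "norm (tensor_apply (G z) (X s t)) \<le> c * K\<^sup>2 * (H * r\<^sup>2) * (1 + norm z)"
    proof -
      have "norm (tensor_apply (G z) (X s t)) \<le> c * K\<^sup>2 * (H * r\<^sup>2)"
        using TA[OF G_K X_H[OF st]] by (simp add: r_def)
      moreover have "0 \<le> c * K\<^sup>2 * (H * r\<^sup>2) * norm z"
        using H \<open>0 \<le> c\<close> by simp
      ultimately show ?thesis
        by (simp add: distrib_left)
    qed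
    ultimately have "norm ((t - s) *\<^sub>R f z + tensor_apply (G z) (X s t))
        \<le> (H * r\<^sup>2) * (E * (1 + norm z)) + c * K\<^sup>2 * (H * r\<^sup>2) * (1 + norm z)"
      by (rule norm_triangle_mono)
    then show ?thesis
      by (simp add: \<phi>_eq r_def algebra_simps)
  qed
  define B where "B = (H * E + c * K\<^sup>2 * H)"
  have B: "0 \<le> B"
    using H E K \<open>0 \<le> c\<close> by (simp add: B_def)
  define C1 where "C1 = B * H + K * H"
  have first_order: "norm (?\<phi> s t z) \<le> C1 * (t - s) powr \<nu> * (1 + norm z)"
    if st: "a \<le> s" "s \<le> t" "t \<le> b" for s t z
  proof -
    define r where "r = (t - s) powr \<nu>"
    have r: "0 \<le> r" "r \<le> H"
      using r_H[OF st] by (auto simp: r_def)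
    have "norm (g z (x t - x s)) \<le> K * (H * r)"
      using x_H[OF st] K unfolding r_def by (intro order_trans[OF norm_blinfun] mult_mono) auto
    moreover have "B * r\<^sup>2 * (1 + norm z) \<le> B * (H * r) * (1 + norm z)"
      using r B unfolding power2_eq_square by (intro mult_right_mono mult_left_mono) auto
    moreover have "norm (?\<phi> s t z) \<le> norm (?\<phi> s t z - g z (x t - x s)) + norm (g z (x t - x s))"
      using norm_triangle_ineq[of "?\<phi> s t z - g z (x t - x s)" "g z (x t - x s)"] by simp
    moreover have "K * (H * r) \<le> K * (H * r) * (1 + norm z)"
      using K(1) H r by (simp add: distrib_left)
    ultimately have "norm (?\<phi> s t z) \<le> B * (H * r) * (1 + norm z) + K * (H * r) * (1 + norm z)"
      using second_order[OF st, of z, folded B_def r_def] by linarith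
    also have "\<dots> = C1 * r * (1 + norm z)"
      by (simp add: C1_def algebra_simps)
    finally show ?thesis
      by (simp add: r_def)
  qed
  have C1: "0 \<le> C1"
    using B K H by (simp add: C1_def)
  define C2 where "C2 = H\<^sup>2 * L + K * H + 2 * c * K\<^sup>2 * H\<^sup>2"
  have C2: "0 \<le> C2"
    using K H L \<open>0 \<le> c\<close> by (simp add: C2_def)
  have lip: "norm (?\<phi> s t z - ?\<phi> s t w) \<le> C2 * (t - s) powr \<nu> * norm (z - w)"
    if st: "a \<le> s" "s \<le> t" "t \<le> b" for s t z w
  proof -
    define r where "r = (t - s) powr \<nu>"
    have r: "0 \<le> r" "r \<le> H"
      using r_H[OF st] by (auto simp: r_def)
    define \<delta> where "\<delta> = norm (z - w)"
    have "0 \<le> \<delta>" by (simp add: \<delta>_def)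
    have rr: "r\<^sup>2 \<le> H * r"
      using r unfolding power2_eq_square by (intro mult_right_mono) auto
    have Hrr: "H * r\<^sup>2 \<le> H\<^sup>2 * r"
      using mult_left_mono[OF rr H] by (simp add: power2_eq_square mult_ac)
    have "norm ((t - s) *\<^sub>R (f z - f w)) \<le> (H * r\<^sup>2) * (L * \<delta>)"
      using t_H[OF st] f_lip[of z w] st unfolding norm_scaleR r_def \<delta>_def by (intro mult_mono) auto
    also have "\<dots> \<le> (H\<^sup>2 * r) * (L * \<delta>)"
      using Hrr L \<open>0 \<le> \<delta>\<close> by (intro mult_right_mono) auto
    finally have 1: "norm ((t - s) *\<^sub>R (f z - f w)) \<le> (H\<^sup>2 * r) * (L * \<delta>)" .
    have 2: "norm ((g z - g w) (x t - x s)) \<le> (K * \<delta>) * (H * r)"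
      using x_H[OF st] g_lip[of z w] K unfolding r_def \<delta>_def
      by (intro order_trans[OF norm_blinfun] mult_mono) auto
    have "norm (tensor_apply (G z - G w) (X s t)) \<le> c * (2 * K\<^sup>2 * \<delta>) * (H * r\<^sup>2)"
      using TA[OF G_lip X_H[OF st]] by (simp add: r_def \<delta>_def)
    also have "\<dots> \<le> c * (2 * K\<^sup>2 * \<delta>) * (H\<^sup>2 * r)"
      using Hrr \<open>0 \<le> c\<close> \<open>0 \<le> \<delta>\<close> by (intro mult_left_mono) auto
    finally have 3: "norm (tensor_apply (G z - G w) (X s t)) \<le> c * (2 * K\<^sup>2 * \<delta>) * (H\<^sup>2 * r)" .
    have "?\<phi> s t z - ?\<phi> s t w = (t - s) *\<^sub>R (f z - f w) + (g z - g w) (x t - x s) + tensor_apply (G z - G w) (X s t)"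
      by (simp add: \<phi>_eq tensor_apply_diff_left blinfun.diff_left algebra_simps)
    also have "norm \<dots> \<le> (H\<^sup>2 * r) * (L * \<delta>) + (K * \<delta>) * (H * r) + c * (2 * K\<^sup>2 * \<delta>) * (H\<^sup>2 * r)"
      by (intro norm_triangle_mono 1 2 3)
    also have "\<dots> = C2 * r * \<delta>"
      by (simp add: C2_def algebra_simps)
    finally show ?thesis
      by (simp add: r_def \<delta>_def)
  qed
  define C3 where "C3 = H * L * C1 + c * (2 * K\<^sup>2 * C1) * H + K * B * H + K * (K * H)\<^sup>2 * H"
  have C3: "0 \<le> C3"
    using K H L B C1 \<open>0 \<le> c\<close> by (simp add: C3_def)
  have defect: "norm (?\<phi> s t z - ?\<phi> s u z - ?\<phi> u t (z + ?\<phi> s u z)) \<le> C3 * (t - s) powr (3 * \<nu>) * (1 + norm z)"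
    if sut: "a \<le> s" "s \<le> u" "u \<le> t" "t \<le> b" for s u t z
  proof -
    have su: "a \<le> s" "s \<le> u" "u \<le> b" and ut: "a \<le> u" "u \<le> t" "t \<le> b" and st: "a \<le> s" "s \<le> t" "t \<le> b"
      using sut by auto
    define r where "r = (t - s) powr \<nu>"
    define W where "W = 1 + norm z"
    have W: "1 \<le> W"
      by (simp add: W_def)
    have r: "0 \<le> r" "(u - s) powr \<nu> \<le> r" "(t - u) powr \<nu> \<le> r"
      using sut \<nu> by (auto simp: r_def intro!: powr_mono2)
    have r2: "((u - s) powr \<nu>)\<^sup>2 \<le> r\<^sup>2" "((t - u) powr \<nu>)\<^sup>2 \<le> r\<^sup>2"
      using r by (auto intro!: power_mono)
    define w where "w = blinfun_apply (g z) (x u - x s)"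
    define z' where "z' = z + ?\<phi> s u z"
    have zz': "norm (z - z') \<le> C1 * r * W"
    proof -
      have "norm (z - z') \<le> C1 * (u - s) powr \<nu> * W"
        using first_order[OF su, of z] by (simp add: z'_def W_def)
      also have "\<dots> \<le> C1 * r * W"
        using r W C1 by (intro mult_right_mono mult_left_mono) auto
      finally show ?thesis .
    qed
    have zw: "norm (z' - (z + w)) \<le> B * r\<^sup>2 * W"
    proof -
      have "norm (z' - (z + w)) \<le> B * ((u - s) powr \<nu>)\<^sup>2 * W"
        using second_order[OF su, of z] by (simp add: z'_def w_def W_def B_def)
      also have "\<dots> \<le> B * r\<^sup>2 * W"
        using r2 W B by (intro mult_right_mono mult_left_mono) auto
      finally show ?thesis .
    qed
    have dt: "t - u \<le> H * r\<^sup>2"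
      using t_H[OF ut] mult_left_mono[OF r2(2) H] by linarith
    have dX: "norm (X u t) \<le> H * r\<^sup>2"
      using X_H[OF ut] mult_left_mono[OF r2(2) H] by linarith
    have dx: "norm (x t - x u) \<le> H * r"
      using x_H[OF ut] mult_left_mono[OF r(3) H] by linarith
    have w: "norm w \<le> K * (H * r)"
    proof -
      have "norm (x u - x s) \<le> H * r"
        using x_H[OF su] mult_left_mono[OF r(2) H] by linarith
      then show ?thesis
        unfolding w_def using K by (intro order_trans[OF norm_blinfun] mult_mono) auto
    qed
    have 1: "norm ((t - u) *\<^sub>R (f z - f z')) \<le> (H * r\<^sup>2) * (L * (C1 * r * W))"
      using dt sut order_trans[OF f_lip mult_left_mono[OF zz' L]] unfolding norm_scaleR
      by (intro mult_mono) auto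
    have 2: "norm (tensor_apply (G z - G z') (X u t)) \<le> c * (2 * K\<^sup>2 * (C1 * r * W)) * (H * r\<^sup>2)"
      using order_trans[OF G_lip mult_left_mono[OF zz']] by (intro TA dX) auto
    have 3: "norm ((g z' - g (z + w)) (x t - x u)) \<le> (K * (B * r\<^sup>2 * W)) * (H * r)"
      using dx order_trans[OF g_lip mult_left_mono[OF zw K(1)]] order_trans[OF norm_ge_zero zw] K(1)
      by (intro order_trans[OF norm_blinfun] mult_mono) auto
    have 4: "norm ((g (z + w) - g z - fderiv g z w) (x t - x u)) \<le> (K * (K * (H * r))\<^sup>2 * W) * (H * r)"
    proof -
      have "norm (g (z + w) - g z - fderiv g z w) \<le> K * (norm w)\<^sup>2"
        by (rule taylor)
      also have "\<dots> \<le> K * (K * (H * r))\<^sup>2"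
        using w K(1) by (intro mult_left_mono power_mono) auto
      also have "\<dots> \<le> K * (K * (H * r))\<^sup>2 * W"
        using W K(1) mult_left_mono[of 1 W "K * (K * (H * r))\<^sup>2"] by simp
      finally show ?thesis
        using dx K(1) W by (intro order_trans[OF norm_blinfun] mult_mono) auto
    qed
    have "X s t - X s u - X u t = tensor (x u - x s) (x t - x u)"
      using rp sut unfolding rough_path_def by auto
    then have "?\<phi> s t z - ?\<phi> s u z - ?\<phi> u t z'
      = (t - u) *\<^sub>R (f z - f z') + tensor_apply (G z - G z') (X u t)
        - (g z' - g (z + w)) (x t - x u) - (g (z + w) - g z - fderiv g z w) (x t - x u)"
      unfolding G_def z'_def w_def by (rule rde_step_defect_eq)
    also have "norm \<dots> \<le> (H * r\<^sup>2) * (L * (C1 * r * W)) + c * (2 * K\<^sup>2 * (C1 * r * W)) * (H * r\<^sup>2)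
        + (K * (B * r\<^sup>2 * W)) * (H * r) + (K * (K * (H * r))\<^sup>2 * W) * (H * r)"
      by (rule order_trans[OF norm_triangle_ineq4 add_mono[OF order_trans[OF norm_triangle_ineq4
              add_mono[OF norm_triangle_mono[OF 1 2] 3]] 4]])
    also have "\<dots> = C3 * r ^ 3 * W"
      by (simp add: C3_def power2_eq_square power3_eq_cube algebra_simps)
    finally show ?thesis
      by (simp add: powr_triple r_def W_def z'_def)
  qed
  have cont: "continuous_on ({a..b} \<times> {a..b}) (\<lambda>(s, t). ?\<phi> s t z)" for z
  proof -
    have x: "continuous_on {a..b} x"
      using rp \<nu> by (intro holder_path_imp_continuous_on[of \<nu>]) (auto simp: rough_path_def)
    have X: "continuous_on ({a..b} \<times> {a..b}) (\<lambda>p. X (fst p) (snd p))"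
      using rp by (simp add: rough_path_def holder_two_param_def split_def)
    have T: "bounded_linear (tensor_apply (G z))"
      by (intro linear_conv_bounded_linear[THEN iffD1] linear_tensor_apply)
    have xs: "continuous_on ({a..b} \<times> {a..b}) (\<lambda>p. x (snd p))" "continuous_on ({a..b} \<times> {a..b}) (\<lambda>p. x (fst p))"
      by (rule continuous_on_compose2[OF x]; force intro: continuous_intros)+
    show ?thesis
      unfolding split_def \<phi>_eq
      by (intro continuous_intros xs bounded_linear.continuous_on[OF T X])
  qed
  define C where "C = Max {C1, C2, C3}"
  have C: "C1 \<le> C" "C2 \<le> C" "C3 \<le> C"
    by (simp_all add: C_def)
  have "almost_flow ?\<phi> a b C \<nu> (3 * \<nu>)"
  proof
    fix s t z w assume st: "a \<le> s" "s \<le> t" "t \<le> b"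
    show "norm (?\<phi> s t z) \<le> C * (t - s) powr \<nu> * (1 + norm z)"
      using first_order[OF st, of z] C by (elim order_trans) (auto intro!: mult_right_mono)
    show "norm (?\<phi> s t z - ?\<phi> s t w) \<le> C * (t - s) powr \<nu> * norm (z - w)"
      using lip[OF st, of z w] C by (elim order_trans) (auto intro!: mult_right_mono)
  next
    fix s u t z assume sut: "a \<le> s" "s \<le> u" "u \<le> t" "t \<le> b"
    show "norm (?\<phi> s t z - ?\<phi> s u z - ?\<phi> u t (z + ?\<phi> s u z)) \<le> C * (t - s) powr (3 * \<nu>) * (1 + norm z)"
      using defect[OF sut, of z] C by (elim order_trans) (auto intro!: mult_right_mono)
  qed (use C C1 \<nu> cont in auto)
  then show ?thesis
    by (rule that)
qed

section \<open>Controlled paths and the rough integral along a path\<close>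

lemma holder_path_if_le:
  assumes "\<And>s t. s \<in> I \<Longrightarrow> t \<in> I \<Longrightarrow> s \<le> t \<Longrightarrow> norm (y t - y s) \<le> C * (t - s) powr \<nu>"
  shows "holder_path \<nu> I y"
  unfolding holder_path_def
proof (intro exI ballI)
  fix s t assume "s \<in> I" "t \<in> I"
  then show "norm (y t - y s) \<le> C * \<bar>t - s\<bar> powr \<nu>"
    using assms[of s t] assms[of t s] by (cases "s \<le> t") (auto simp: norm_minus_commute)
qed

lemma holder_path_lower_exponent:
  assumes "holder_path \<nu> {a..b} y" and "\<alpha> \<le> \<nu>"
  shows "holder_path \<alpha> {a..b} y"
proof -
  obtain C where C: "\<And>s t. s \<in> {a..b} \<Longrightarrow> t \<in> {a..b} \<Longrightarrow> norm (y t - y s) \<le> C * \<bar>t - s\<bar> powr \<nu>"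
    using assms(1) unfolding holder_path_def by blast
  have "norm (y t - y s) \<le> (max 0 C * (b - a) powr (\<nu> - \<alpha>)) * \<bar>t - s\<bar> powr \<alpha>"
    if "s \<in> {a..b}" "t \<in> {a..b}" for s t
  proof -
    have "norm (y t - y s) \<le> max 0 C * \<bar>t - s\<bar> powr \<nu>"
      by (rule order_trans[OF C[OF that]]) (simp add: mult_right_mono)
    also have "\<dots> \<le> max 0 C * ((b - a) powr (\<nu> - \<alpha>) * \<bar>t - s\<bar> powr \<alpha>)"
      using that assms by (intro mult_left_mono powr_le_powr_lower_exponent) auto
    finally show ?thesis
      by (simp add: mult.assoc)
  qed
  then show ?thesis
    unfolding holder_path_def by blast
qed

lemma holder_two_param_lower_exponent:
  assumes "holder_two_param \<nu> {a..b} R" and "\<alpha> \<le> \<nu>"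
  shows "holder_two_param \<alpha> {a..b} R"
proof -
  obtain C where C: "\<And>s t. s \<in> {a..b} \<Longrightarrow> t \<in> {a..b} \<Longrightarrow> s < t \<Longrightarrow> norm (R s t) \<le> C * \<bar>t - s\<bar> powr \<nu>"
    using assms(1) unfolding holder_two_param_def by blast
  have "norm (R s t) \<le> (max 0 C * (b - a) powr (\<nu> - \<alpha>)) * \<bar>t - s\<bar> powr \<alpha>"
    if "s \<in> {a..b}" "t \<in> {a..b}" "s < t" for s t
  proof -
    have "norm (R s t) \<le> max 0 C * \<bar>t - s\<bar> powr \<nu>"
      by (rule order_trans[OF C[OF that]]) (simp add: mult_right_mono)
    also have "\<dots> \<le> max 0 C * ((b - a) powr (\<nu> - \<alpha>) * \<bar>t - s\<bar> powr \<alpha>)"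
      using that assms by (intro mult_left_mono powr_le_powr_lower_exponent) auto
    finally show ?thesis
      by (simp add: mult.assoc)
  qed
  then show ?thesis
    using assms(1) unfolding holder_two_param_def by blast
qed

lemma controlled_path_lower_exponent:
  assumes "controlled_path \<nu> {a..b} x y y'" and "\<alpha> \<le> \<nu>"
  shows "controlled_path \<alpha> {a..b} x y y'"
proof -
  have "holder_two_param (2 * \<alpha>) {a..b} R" if "holder_two_param (2 * \<nu>) {a..b} R" for R :: "real \<Rightarrow> real \<Rightarrow> 'b"
    using that assms(2) by (intro holder_two_param_lower_exponent[OF that]) simp
  then show ?thesis
    using assms holder_path_lower_exponent unfolding controlled_path_def by metis
qed

lemma holder_path_compose:
  assumes "holder_path \<nu> I y" and "0 \<le> K" and lip: "\<And>z w. norm (h z - h w) \<le> K * norm (z - w)"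
  shows "holder_path \<nu> I (\<lambda>t. h (y t))"
proof -
  obtain C where C: "\<And>s t. s \<in> I \<Longrightarrow> t \<in> I \<Longrightarrow> norm (y t - y s) \<le> C * \<bar>t - s\<bar> powr \<nu>"
    using assms(1) unfolding holder_path_def by blast
  have "norm (h (y t) - h (y s)) \<le> (K * C) * \<bar>t - s\<bar> powr \<nu>" if "s \<in> I" "t \<in> I" for s t
    using order_trans[OF lip mult_left_mono[OF C[OF that] assms(2)]] by (simp add: mult.assoc)
  then show ?thesis
    unfolding holder_path_def by blast
qed

text \<open>The remainder of a controlled path is determined by the path and its Gubinelli derivative, so its continuity
  follows from that of the paths and only the bound has to be supplied.\<close>

lemma controlled_path_if_remainder_bound:
  assumes "0 < \<nu>" and "holder_path \<nu> I x" and "holder_path \<nu> I y" and "holder_path \<nu> I y'"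
    and bound: "\<And>s t. s \<in> I \<Longrightarrow> t \<in> I \<Longrightarrow> s \<le> t \<Longrightarrow>
      norm (y t - y s - blinfun_apply (y' s) (x t - x s)) \<le> C * ((t - s) powr \<nu>)\<^sup>2"
  shows "controlled_path \<nu> I x y y'"
proof -
  define R where "R s t = y t - y s - blinfun_apply (y' s) (x t - x s)" for s t
  have cont: "continuous_on (I \<times> I) (\<lambda>p. h (fst p))" "continuous_on (I \<times> I) (\<lambda>p. h (snd p))"
    if "holder_path \<nu> I h" for h :: "real \<Rightarrow> 'c::real_normed_vector"
    by (rule continuous_on_compose2[OF holder_path_imp_continuous_on[OF that assms(1)]];
        auto intro!: continuous_intros)+
  have "continuous_on (I \<times> I) (\<lambda>(s, t). R s t)"
    unfolding R_def split_def using assms by (intro continuous_intros cont)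
  moreover have "norm (R s t) \<le> C * \<bar>t - s\<bar> powr (2 * \<nu>)" if "s \<in> I" "t \<in> I" "s < t" for s t
    using bound[of s t] that by (simp add: R_def powr_double)
  ultimately have "holder_two_param (2 * \<nu>) I R"
    unfolding holder_two_param_def by blast
  moreover have "y t - y s = blinfun_apply (y' s) (x t - x s) + R s t" for s t
    by (simp add: R_def)
  ultimately show ?thesis
    using assms unfolding controlled_path_def by blast
qed

text \<open>Tagging every interval of the division with its left end point reduces this to the telescoping sum for tagged
  divisions. One-point intervals contribute \<open>0\<close>.\<close>

lemma division_of_interval_telescope:
  fixes Z :: "real \<Rightarrow> 'a::real_normed_vector"
  assumes "s \<le> t" and D: "D division_of {s..t}"
  shows "(\<Sum>k\<in>D. Z (Sup k) - Z (Inf k)) = Z t - Z s"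
proof -
  let ?p = "(\<lambda>k. (Inf k, k)) ` D"
  have Inf_mem: "Inf k \<in> k" if k: "k \<in> D" for k
  proof -
    obtain c d where "k = {c..d}" "k \<noteq> {}"
      using division_ofD(3,4)[OF D k] by auto
    then show ?thesis by auto
  qed
  have "?p tagged_division_of {s..t}"
  proof (rule tagged_division_ofI)
    show "finite ?p"
      using division_ofD(1)[OF D] by simp
    show "\<Union>{K. \<exists>x. (x, K) \<in> ?p} = {s..t}"
    proof -
      have "{K. \<exists>x. (x, K) \<in> ?p} = D"
        by auto
      then show ?thesis
        using division_ofD(6)[OF D] by simp
    qed
    show "interior K1 \<inter> interior K2 = {}"
      if "(x1, K1) \<in> ?p" "(x2, K2) \<in> ?p" "(x1, K1) \<noteq> (x2, K2)" for x1 K1 x2 K2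
      using that by (intro division_ofD(5)[OF D]) auto
  qed (use division_ofD(2,4)[OF D] Inf_mem in auto)
  then have "(\<Sum>(u, k)\<in>?p. Z (Sup k) - Z (Inf k)) = Z t - Z s"
    by (rule additive_tagged_division_1[OF assms(1)])
  then show ?thesis
    by (subst (asm) sum.reindex) (auto simp: inj_on_def)
qed

text \<open>If \<open>Z\<close> has the compensated increments of the integrand as its local expansion up to an order \<open>\<theta> > 1\<close>, then \<open>Z\<close> is
  the indefinite rough integral: the Riemann sums differ from the telescoping sum of the increments of \<open>Z\<close> by at
  most \<open>K\<close> times the mesh to the power \<open>\<theta> - 1\<close> times the length of the interval.\<close>

lemma has_rough_integral_if_local_expansion:
  assumes "s \<le> t" and "1 < \<theta>" and "0 \<le> K"
    and expansion: "\<And>u v. s \<le> u \<Longrightarrow> u \<le> v \<Longrightarrow> v \<le> t \<Longrightarrow>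
      norm (Z v - Z u - (blinfun_apply (Y u) (x v - x u) + tensor_apply (Y' u) (X u v)))
        \<le> K * (v - u) powr \<theta>"
  shows "has_rough_integral x X Y Y' (Z t - Z s) s t"
  unfolding has_rough_integral_def
proof (intro allI impI)
  fix \<epsilon> :: real assume \<epsilon>: "0 < \<epsilon>"
  \<comment> \<open>The summand \<open>1\<close> avoids a division by \<open>0\<close>.\<close>
  define q where "q = \<epsilon> / (K * (t - s) + 1)"
  have q: "0 < q" "K * q * (t - s) < \<epsilon>"
  proof -
    have "0 \<le> K * (t - s)"
      using assms by simp
    then show "0 < q" and "K * q * (t - s) < \<epsilon>"
      using \<epsilon> by (auto simp: q_def field_simps)
  qed
  define \<delta> where "\<delta> = q powr (1 / (\<theta> - 1))"
  have \<delta>: "0 < \<delta>" "\<delta> powr (\<theta> - 1) = q"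
    using q assms by (auto simp: \<delta>_def powr_powr)
  define \<Xi> where "\<Xi> k = blinfun_apply (Y (Inf k)) (x (Sup k) - x (Inf k)) + tensor_apply (Y' (Inf k)) (X (Inf k) (Sup k))" for k
  show "\<exists>\<delta>>0. \<forall>D. D division_of {s..t} \<and> (\<forall>k\<in>D. Sup k - Inf k < \<delta>) \<longrightarrow>
      norm ((\<Sum>k\<in>D. blinfun_apply (Y (Inf k)) (x (Sup k) - x (Inf k)) +
                      tensor_apply (Y' (Inf k)) (X (Inf k) (Sup k))) - (Z t - Z s)) < \<epsilon>"
  proof (intro exI[of _ \<delta>] conjI allI impI)
    fix D assume "D division_of {s..t} \<and> (\<forall>k\<in>D. Sup k - Inf k < \<delta>)"
    then have D: "D division_of {s..t}" and mesh: "\<And>k. k \<in> D \<Longrightarrow> Sup k - Inf k < \<delta>"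
      by auto
    have piece: "norm (\<Xi> k - (Z (Sup k) - Z (Inf k))) \<le> K * q * (Sup k - Inf k)" if k: "k \<in> D" for k
    proof -
      obtain u v where uv: "k = {u..v}" "u \<le> v" "s \<le> u" "v \<le> t"
        using division_ofD(2-4)[OF D k] by (metis atLeastatMost_empty_iff atLeastatMost_subset_iff box_real(2))
      then have k_bounds: "Inf k = u" "Sup k = v"
        by auto
      have "norm (\<Xi> k - (Z v - Z u)) \<le> K * (v - u) powr \<theta>"
        using expansion[of u v] uv unfolding \<Xi>_def k_bounds by (metis norm_minus_commute)
      also have "(v - u) powr \<theta> \<le> \<delta> powr (\<theta> - 1) * (v - u)"
        using powr_le_powr_lower_exponent[of "v - u" \<delta> 1 \<theta>] mesh[OF k] uv assms unfolding k_bounds by simp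
      finally show ?thesis
        unfolding k_bounds \<delta>(2) using assms(3) by (simp add: mult_left_mono mult.assoc)
    qed
    have "(\<Sum>k\<in>D. \<Xi> k) - (Z t - Z s) = (\<Sum>k\<in>D. \<Xi> k - (Z (Sup k) - Z (Inf k)))"
      using division_of_interval_telescope[OF assms(1) D, of Z] by (simp add: sum_subtractf)
    also have "norm \<dots> \<le> (\<Sum>k\<in>D. K * q * (Sup k - Inf k))"
      using piece by (rule sum_norm_le)
    also have "\<dots> = K * q * (t - s)"
      using division_of_interval_telescope[OF assms(1) D, of "\<lambda>u. u"] by (simp flip: sum_distrib_left)
    finally show "norm ((\<Sum>k\<in>D. blinfun_apply (Y (Inf k)) (x (Sup k) - x (Inf k)) +
                      tensor_apply (Y' (Inf k)) (X (Inf k) (Sup k))) - (Z t - Z s)) < \<epsilon>"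
      using q(2) unfolding \<Xi>_def by linarith
  qed (rule \<delta>(1))
qed

section \<open>Solutions of the rough differential equation\<close>

text \<open>Davie's expansion implies all parts of the definition of a solution. Dropping the drift and the second level from
  it leaves the controlled path property of \<open>y\<close>; composing with \<open>g\<close> and Taylor's formula gives that of \<open>g (y)\<close>. Since \<open>f\<close>
  is Lipschitz and \<open>y\<close> is \<open>\<nu>\<close>-Hoelder, the drift integral over \<open>{u..v}\<close> differs from \<open>(v - u) *\<^sub>R f (y u)\<close> by the
  order \<open>1 + \<nu> \<ge> 3 * \<nu>\<close>, so \<open>y\<close> minus the drift integral has the compensated increments of the rough integral as its
  expansion.\<close>

lemma rde_solution_if_davie_expansion:
  fixes x :: "real \<Rightarrow> real ^ 'm" and f :: "real ^ 'd \<Rightarrow> real ^ 'd"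
  assumes rp: "rough_path \<nu> {a..b} x X" and \<nu>: "1 / 3 < \<nu>" "\<nu> < 1 / 2"
    and \<alpha>: "\<alpha> \<le> \<nu>" and "a \<le> b"
    and f: "L-lipschitz_on UNIV f" and g: "C3b g"
    and "0 \<le> K"
    and davie: "\<And>s t. a \<le> s \<Longrightarrow> s \<le> t \<Longrightarrow> t \<le> b \<Longrightarrow>
      norm (y t - y s - rde_step x X f g s t (y s)) \<le> K * (t - s) powr (3 * \<nu>)"
  shows "rde_solution \<alpha> a b x X f g (y a) y"
proof -
  have "0 < \<nu>" using \<nu> by simp
  obtain H where H: "0 \<le> H"
    and r_H: "\<And>s t. a \<le> s \<Longrightarrow> s \<le> t \<Longrightarrow> t \<le> b \<Longrightarrow> (t - s) powr \<nu> \<le> H"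
    and t_H: "\<And>s t. a \<le> s \<Longrightarrow> s \<le> t \<Longrightarrow> t \<le> b \<Longrightarrow> t - s \<le> H * ((t - s) powr \<nu>)\<^sup>2"
    and x_H: "\<And>s t. a \<le> s \<Longrightarrow> s \<le> t \<Longrightarrow> t \<le> b \<Longrightarrow> norm (x t - x s) \<le> H * (t - s) powr \<nu>"
    and X_H: "\<And>s t. a \<le> s \<Longrightarrow> s \<le> t \<Longrightarrow> t \<le> b \<Longrightarrow> norm (X s t) \<le> H * ((t - s) powr \<nu>)\<^sup>2"
    by (rule rough_path_bounds[OF rp \<nu>(2) \<open>0 < \<nu>\<close>]) blast
  obtain B where B: "0 \<le> B" "\<And>z. norm (g z) \<le> B" "\<And>z. norm (fderiv g z) \<le> B"
    and g_lip: "\<And>z w. norm (g z - g w) \<le> B * norm (z - w)"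
    and dg_lip: "\<And>z w. norm (fderiv g z - fderiv g w) \<le> B * norm (z - w)"
    and taylor: "\<And>z w. norm (g (z + w) - g z - fderiv g z w) \<le> B * (norm w)\<^sup>2"
    by (rule C3b_bounds[OF g]) blast
  obtain C where "almost_flow (rde_step x X f g) a b C \<nu> (3 * \<nu>)"
    using rde_step_almost_flow[OF rp \<nu> f g] .
  then interpret almost_flow "rde_step x X f g" a b C \<nu> "3 * \<nu>" .
  have xh: "holder_path \<nu> {a..b} x"
    using rp by (simp add: rough_path_def)

  have cube: "K * (t - s) powr (3 * \<nu>) \<le> K * H * ((t - s) powr \<nu>)\<^sup>2" if "a \<le> s" "s \<le> t" "t \<le> b" for s t
  proof -
    have "(t - s) powr \<nu> * ((t - s) powr \<nu>)\<^sup>2 \<le> H * ((t - s) powr \<nu>)\<^sup>2"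
      using r_H[OF that] by (rule mult_right_mono) simp
    from mult_left_mono[OF this \<open>0 \<le> K\<close>] show ?thesis
      by (simp add: powr_triple power3_eq_cube power2_eq_square mult.assoc)
  qed
  have y_bounded: "\<exists>R. \<forall>t\<in>{a..b}. norm (y t) \<le> R"
  proof (intro exI ballI)
    fix t assume "t \<in> {a..b}"
    then have t: "a \<le> a" "a \<le> t" "t \<le> b" by auto
    have "norm (y t) \<le> norm (y a) + norm (rde_step x X f g a t (y a)) + norm (y t - y a - rde_step x X f g a t (y a))"
      using norm_triangle_ineq[of "y a" "y t - y a"] norm_triangle_sub[of "y t - y a" "rde_step x X f g a t (y a)"]
      by simp
    also have "\<dots> \<le> norm (y a) + C * H * (1 + norm (y a)) + K * H * H\<^sup>2"
    proof (intro add_mono order_refl)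
      show "norm (rde_step x X f g a t (y a)) \<le> C * H * (1 + norm (y a))"
        using r_H[OF t] C_nonneg by (intro order_trans[OF growth[OF t]] mult_right_mono mult_left_mono) auto
      show "norm (y t - y a - rde_step x X f g a t (y a)) \<le> K * H * H\<^sup>2"
        using r_H[OF t] \<open>0 \<le> K\<close> H
        by (intro order_trans[OF davie[OF t]] order_trans[OF cube[OF t]] mult_left_mono power_mono) auto
    qed
    finally show "norm (y t) \<le> norm (y a) + C * H * (1 + norm (y a)) + K * H * H\<^sup>2" .
  qed
  then obtain R where R: "\<And>t. t \<in> {a..b} \<Longrightarrow> norm (y t) \<le> R" by blast

  define Cy where "Cy = C * (1 + R) + K * H * H"
  have y_incr: "norm (y t - y s) \<le> Cy * (t - s) powr \<nu>" if st: "a \<le> s" "s \<le> t" "t \<le> b" for s t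
  proof -
    define r where "r = (t - s) powr \<nu>"
    have r: "0 \<le> r" "r \<le> H"
      using r_H[OF st] by (auto simp: r_def)
    have "norm (rde_step x X f g s t (y s)) \<le> C * r * (1 + norm (y s))"
      using growth[OF st] by (simp add: r_def)
    also have "\<dots> \<le> C * r * (1 + R)"
      using R[of s] st r C_nonneg by (intro mult_left_mono) auto
    finally have 1: "norm (rde_step x X f g s t (y s)) \<le> C * r * (1 + R)" .
    have "K * H * r\<^sup>2 \<le> K * H * (H * r)"
      using r H \<open>0 \<le> K\<close> unfolding power2_eq_square by (intro mult_left_mono mult_right_mono) auto
    then have 2: "norm (y t - y s - rde_step x X f g s t (y s)) \<le> K * H * (H * r)"
      using davie[OF st] cube[OF st, folded r_def] by linarith
    have "norm (y t - y s) \<le> C * r * (1 + R) + K * H * (H * r)"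
      using norm_triangle_sub[of "y t - y s" "rde_step x X f g s t (y s)"] 1 2 by linarith
    also have "\<dots> = Cy * r"
      by (simp add: Cy_def algebra_simps)
    finally show ?thesis
      by (simp add: r_def)
  qed
  have yh: "holder_path \<nu> {a..b} y"
    using y_incr by (intro holder_path_if_le) auto
  have y_cont: "continuous_on {a..b} y"
    using yh \<open>0 < \<nu>\<close> by (rule holder_path_imp_continuous_on)

  have fy_cont: "continuous_on {a..b} (\<lambda>u. f (y u))"
    using continuous_on_compose2[OF lipschitz_on_continuous_on[OF f] y_cont] by simp
  have "bounded ((\<lambda>u. f (y u)) ` {a..b})"
    using compact_imp_bounded[OF compact_continuous_image[OF fy_cont compact_Icc]] .
  then obtain E where E: "0 < E" "\<And>u. u \<in> {a..b} \<Longrightarrow> norm (f (y u)) \<le> E"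
    unfolding bounded_pos by blast

  define c where "c = (real CARD('m))\<^sup>2"
  define CR where "CR = K * H + H * E + c * (B * B) * H"
  have y_rem: "norm (y t - y s - g (y s) (x t - x s)) \<le> CR * ((t - s) powr \<nu>)\<^sup>2"
    if st: "a \<le> s" "s \<le> t" "t \<le> b" for s t
  proof -
    define r where "r = (t - s) powr \<nu>"
    define G where "G = fderiv g (y s) o\<^sub>L g (y s)"
    have "norm G \<le> B * B"
      unfolding G_def using B by (intro order_trans[OF norm_blinfun_compose] mult_mono) auto
    then have 1: "norm (tensor_apply G (X s t)) \<le> c * (B * B) * (H * r\<^sup>2)"
      using X_H[OF st] unfolding c_def r_def
      by (intro order_trans[OF norm_tensor_apply_le] mult_mono) auto
    have 2: "norm ((t - s) *\<^sub>R f (y s)) \<le> (H * r\<^sup>2) * E"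
      using t_H[OF st] E(2)[of s] st unfolding norm_scaleR r_def by (intro mult_mono) auto
    have 3: "norm (y t - y s - rde_step x X f g s t (y s)) \<le> K * H * r\<^sup>2"
      using davie[OF st] cube[OF st] unfolding r_def by linarith
    have "y t - y s - g (y s) (x t - x s) = (y t - y s - rde_step x X f g s t (y s)) + (t - s) *\<^sub>R f (y s) + tensor_apply G (X s t)"
      by (simp add: rde_step_def G_def)
    also have "norm \<dots> \<le> K * H * r\<^sup>2 + (H * r\<^sup>2) * E + c * (B * B) * (H * r\<^sup>2)"
      by (intro norm_triangle_mono 1 2 3)
    also have "\<dots> = CR * r\<^sup>2"
      by (simp add: CR_def algebra_simps)
    finally show ?thesis
      by (simp add: r_def)
  qed
  have gyh: "holder_path \<nu> {a..b} (\<lambda>t. g (y t))"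
    using yh B(1) g_lip by (rule holder_path_compose)
  have Gyh: "holder_path \<nu> {a..b} (\<lambda>t. fderiv g (y t) o\<^sub>L g (y t))"
    using norm_compose_fderiv_diff_le[OF B g_lip dg_lip]
    by (intro holder_path_compose[OF yh, of "2 * B\<^sup>2" "\<lambda>z. fderiv g z o\<^sub>L g z"]) auto
  have y_controlled: "controlled_path \<nu> {a..b} x y (\<lambda>t. g (y t))"
    using y_rem by (intro controlled_path_if_remainder_bound[OF \<open>0 < \<nu>\<close> xh yh gyh]) auto
  have gy_controlled: "controlled_path \<nu> {a..b} x (\<lambda>t. g (y t)) (\<lambda>t. fderiv g (y t) o\<^sub>L g (y t))"
  proof (rule controlled_path_if_remainder_bound[OF \<open>0 < \<nu>\<close> xh gyh Gyh])
    fix s t assume "s \<in> {a..b}" "t \<in> {a..b}" "s \<le> t"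
    then have st: "a \<le> s" "s \<le> t" "t \<le> b" by auto
    define r where "r = (t - s) powr \<nu>"
    have "norm (g (y s + (y t - y s)) - g (y s) - fderiv g (y s) (y t - y s)) \<le> B * (norm (y t - y s))\<^sup>2"
      by (rule taylor)
    also have "\<dots> \<le> B * (Cy * r)\<^sup>2"
      using y_incr[OF st] B(1) unfolding r_def by (intro mult_left_mono power_mono) auto
    finally have 1: "norm (g (y t) - g (y s) - fderiv g (y s) (y t - y s)) \<le> B * (Cy * r)\<^sup>2"
      by simp
    have 2: "norm (fderiv g (y s) (y t - y s - g (y s) (x t - x s))) \<le> B * (CR * r\<^sup>2)"
      using y_rem[OF st] B unfolding r_def by (intro order_trans[OF norm_blinfun] mult_mono) auto
    have "g (y t) - g (y s) - (fderiv g (y s) o\<^sub>L g (y s)) (x t - x s)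
      = (g (y t) - g (y s) - fderiv g (y s) (y t - y s)) + fderiv g (y s) (y t - y s - g (y s) (x t - x s))"
      by (simp add: blinfun.diff_right)
    also have "norm \<dots> \<le> B * (Cy * r)\<^sup>2 + B * (CR * r\<^sup>2)"
      by (intro norm_triangle_mono 1 2)
    also have "\<dots> = (B * Cy\<^sup>2 + B * CR) * r\<^sup>2"
      by (simp add: power_mult_distrib algebra_simps)
    finally show "norm (g (y t) - g (y s) - (fderiv g (y s) o\<^sub>L g (y s)) (x t - x s)) \<le> (B * Cy\<^sup>2 + B * CR) * ((t - s) powr \<nu>)\<^sup>2"
      by (simp add: r_def)
  qed

  define F where "F t = integral {a..t} (\<lambda>u. f (y u))" for t
  define Z where "Z t = y t - F t" for t
  have L: "0 \<le> L"
    using lipschitz_on_nonneg[OF f] .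
  have Cy: "0 \<le> Cy"
  proof -
    have "0 \<le> R" using R[of a] norm_ge_zero[of "y a"] \<open>a \<le> b\<close> by (meson atLeastAtMost_iff order_refl order_trans)
    then show ?thesis using C_nonneg \<open>0 \<le> K\<close> H by (simp add: Cy_def)
  qed
  define K' where "K' = K + L * Cy * H"
  have Z_expansion: "norm (Z v - Z u - (g (y u) (x v - x u) + tensor_apply (fderiv g (y u) o\<^sub>L g (y u)) (X u v)))
      \<le> K' * (v - u) powr (3 * \<nu>)" if uv: "a \<le> u" "u \<le> v" "v \<le> b" for u v
  proof -
    define r where "r = (v - u) powr \<nu>"
    have int: "(\<lambda>w. f (y w)) integrable_on {c..d}" if "a \<le> c" "d \<le> b" for c d
      using that by (intro integrable_continuous_real continuous_on_subset[OF fy_cont]) auto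
    have Fuv: "F v - F u = integral {u..v} (\<lambda>w. f (y w))"
      using Henstock_Kurzweil_Integration.integral_combine[of a u v, OF _ _ int] uv unfolding F_def
      by (simp add: algebra_simps)
    have "((\<lambda>w. f (y w) - f (y u)) has_integral (F v - F u - (v - u) *\<^sub>R f (y u))) {u..v}"
      using has_integral_diff[OF integrable_integral[OF int] has_integral_const_real[of "f (y u)"], of u v] uv
      unfolding Fuv by simp
    then have "norm (F v - F u - (v - u) *\<^sub>R f (y u)) \<le> L * (Cy * r) * measure lborel (cbox u v)"
    proof (intro has_integral_bound[where f = "\<lambda>w. f (y w) - f (y u)"])
      fix w assume "w \<in> cbox u v"
      then have w: "u \<le> w" "w \<le> v" "w \<le> b"
        using uv by auto
      have "norm (y w - y u) \<le> Cy * (w - u) powr \<nu>"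
        using y_incr[of u w] uv w by auto
      also have "\<dots> \<le> Cy * r"
        unfolding r_def using w Cy \<open>0 < \<nu>\<close> by (intro mult_left_mono powr_mono2) auto
      finally show "norm (f (y w) - f (y u)) \<le> L * (Cy * r)"
        using lipschitz_onD[OF f, of "y w" "y u"] L mult_left_mono[of _ "Cy * r" L] by (fastforce simp: dist_norm)
    qed (use L Cy in \<open>auto simp: r_def\<close>)
    also have "\<dots> \<le> L * (Cy * r) * (H * r\<^sup>2)"
      using t_H[OF uv] uv L Cy by (intro mult_left_mono) (auto simp: r_def)
    also have "\<dots> = (L * Cy * H) * (v - u) powr (3 * \<nu>)"
      by (simp add: powr_triple r_def power3_eq_cube power2_eq_square)
    finally have 1: "norm (F v - F u - (v - u) *\<^sub>R f (y u)) \<le> (L * Cy * H) * (v - u) powr (3 * \<nu>)" .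
    have "Z v - Z u - (g (y u) (x v - x u) + tensor_apply (fderiv g (y u) o\<^sub>L g (y u)) (X u v))
      = (y v - y u - rde_step x X f g u v (y u)) - (F v - F u - (v - u) *\<^sub>R f (y u))"
      by (simp add: Z_def rde_step_def)
    also have "norm \<dots> \<le> K * (v - u) powr (3 * \<nu>) + (L * Cy * H) * (v - u) powr (3 * \<nu>)"
      by (rule order_trans[OF norm_triangle_ineq4 add_mono[OF davie[OF uv] 1]])
    finally show ?thesis
      by (simp add: K'_def distrib_right)
  qed
  have "\<exists>F J. ((\<lambda>u. f (y u)) has_integral F) {a..t} \<and>
        has_rough_integral x X (\<lambda>u. g (y u)) (\<lambda>u. fderiv g (y u) o\<^sub>L g (y u)) J a t \<and>
        y t = y a + F + J" if t: "t \<in> {a..b}" for t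
  proof (intro exI conjI)
    show "((\<lambda>u. f (y u)) has_integral F t) {a..t}"
      unfolding F_def using t
      by (intro integrable_integral integrable_continuous_real continuous_on_subset[OF fy_cont]) auto
    show "has_rough_integral x X (\<lambda>u. g (y u)) (\<lambda>u. fderiv g (y u) o\<^sub>L g (y u)) (Z t - Z a) a t"
    proof (rule has_rough_integral_if_local_expansion[where \<theta> = "3 * \<nu>" and K = K'])
      show "0 \<le> K'"
        using L Cy H \<open>0 \<le> K\<close> by (simp add: K'_def)
    qed (use t \<nu> Z_expansion in auto)
    show "y t = y a + F t + (Z t - Z a)"
      by (simp add: Z_def F_def)
  qed
  then show ?thesis
    unfolding rde_solution_def
    using controlled_path_lower_exponent[OF y_controlled \<alpha>] controlled_path_lower_exponent[OF gy_controlled \<alpha>]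
    by blast
qed

theorem theorem3p7:
  fixes \<alpha> \<nu> a b :: real
    and x :: "real \<Rightarrow> real ^ 'm" and X :: "real \<Rightarrow> real \<Rightarrow> real ^ 'm ^ 'm"
    and f :: "real ^ 'd \<Rightarrow> real ^ 'd"
    and g :: "real ^ 'd \<Rightarrow> (real ^ 'm) \<Rightarrow>\<^sub>L (real ^ 'd)"
  assumes "1 / 3 < \<alpha>" and "\<alpha> < \<nu>" and "\<nu> < 1 / 2"
    and "a \<le> b"
    and "\<exists>L. L-lipschitz_on UNIV f"
    and "C3b g"
    and "rough_path \<nu> {a..b} x X"
  shows "\<forall>y0. \<exists>y. rde_solution \<alpha> a b x X f g y0 y"
proof
  fix y0
  obtain L where L: "L-lipschitz_on UNIV f"
    using assms(5) by blast
  have \<nu>: "1 / 3 < \<nu>" using assms(1,2) by simp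
  obtain C where "almost_flow (rde_step x X f g) a b C \<nu> (3 * \<nu>)"
    using rde_step_almost_flow[OF assms(7) \<nu> assms(3) L assms(6)] .
  then obtain y K where y: "y a = y0" "0 \<le> K"
    "\<And>s t. a \<le> s \<Longrightarrow> s \<le> t \<Longrightarrow> t \<le> b \<Longrightarrow>
      norm (y t - y s - rde_step x X f g s t (y s)) \<le> K * (t - s) powr (3 * \<nu>)"
    by (rule almost_flow.davie_path_exists[OF _ assms(4)]) blast
  have "rde_solution \<alpha> a b x X f g (y a) y"
    using rde_solution_if_davie_expansion[OF assms(7) \<nu> assms(3) less_imp_le[OF assms(2)] assms(4) L assms(6) y(2,3)] .
  then show "\<exists>y. rde_solution \<alpha> a b x X f g y0 y"
    unfolding y(1) by blast
qed

end
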